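(* Suppose that for a sequence of boundary conditions $\{\tilde\omega_{\Lambda^c}\}_\Lambda$, such that the finite volume Gibbs measures $\mu_{\phi,\Lambda,\tilde\omega_{\Lambda^c}}$ converge weakly as $\Lambda$ diverges along a specific sequence of finite subsets of $V$, the following occurs: for each finite $\Lambda_0\subset V$ and each $\epsilon>0$ there are finite sets $\Lambda_1,\Lambda_2\subset V$ such that (a) $\overline P_{\phi,\Lambda_3,\tilde\omega_{\Lambda_3^c}}\big(\Lambda_0\xleftrightarrow{act}\delta\Lambda_1\big)\le\epsilon$ or, alternatively, (b) $\rho_{\phi,\Lambda_3,\tilde\omega_{\Lambda_3^c}}\Big(\big\{\sigma: P^\sigma_{\phi,\Lambda_3,\tilde\omega_{\Lambda_3^c}}(\Lambda_0\xleftrightarrow{act}\delta\Lambda_1)\le\epsilon\big\}\Big)\ge1-\epsilon$ for all $\Lambda_3\supseteq\Lambda_2$ in the sequence of $\Lambda$'s. Then the weak limit $\mu$ of $\mu_{\phi,\Lambda,\tilde\omega_{\Lambda^c}}$ is extremal (in the convex set $K_\phi$ of Gibbs states for $\phi$).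
   Context: Setting. $V$ is the vertex set of an infinite graph; $\mathcal B$ is a locally finite family of finite subsets of $V$ (hyperbonds). For finite $\Lambda\subset V$, $\delta\Lambda$ is the set of $v\in V$ for which there is $b\in\mathcal B$ with $v\in b$, $b\cap\Lambda\ne\emptyset$, $b\cap\Lambda^c\neq\emptyset$. $F\subset\mathbb R$ is a finite alphabet, $\Omega_C=F^C$ for $C\subseteq V$, and $\omega_{C_1}\omega_{C_2}$ denotes the concatenation of configurations on disjoint sets. An interaction is a map $\phi:\bigcup_{b\in\mathcal B}\Omega_b\to\mathbb R\cup\{-\infty\}$ (with $e^{-\infty}=0$, allowing hard constraints). For finite $\Lambda\subset V$ put $\mathcal B_\Lambda=\{b\in\mathcal B:b\cap\Lambda\ne\emptyset\}$. Given a boundary condition $\tilde\omega_{\Lambda^c}\in F^{\Lambda^c}$, the $\mathcal B$-Gibbs measure on $\Omega_\Lambda$ is $$\mu_{\phi,\Lambda,\tilde\omega_{\Lambda^c}}(\omega_\Lambda)=\frac1Z\exp\Big(\sum_{b\in\mathcal B,\,b\subseteq\Lambda}\phi(\omega_b)+\sum_{b:\,b\cap\Lambda\neq\emptyset,\,b\cap\Lambda^c\ne\emptyset}\phi(\omega_{b\cap\Lambda}\tilde\omega_{b\cap\Lambda^c})\Big),$$ where $Z$ is the normalizing constant (assumed positive). $K_\phi$ is the set of Gibbs states for $\phi$: probability measures on $F^V$ whose conditional distribution on each finite $\Lambda$ given the configuration $\omega_{\Lambda^c}$ outside is $\mu_{\phi,\Lambda,\omega_{\Lambda^c}}$, almost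 surely. Weak convergence means convergence of probabilities of all events depending on finitely many coordinates. Overlap and non-overlap distributions. Let $\tilde F=\{a_1+a_2:a_1,a_2\in F\}$, $\Sigma=\tilde F^\Lambda$. For $\sigma\in\Sigma$ let $W_\sigma=\{(\omega^{(1)},\omega^{(2)})\in\Omega_\Lambda^2:\omega^{(1)}_i+\omega^{(2)}_i=\sigma_i\ \forall i\in\Lambda\}$. With $\mu_\Lambda=\mu_{\phi,\Lambda,\tilde\omega_{\Lambda^c}}$, the overlap configuration distribution is $\rho_{\phi,\Lambda,\tilde\omega_{\Lambda^c}}(\sigma)=(\mu_\Lambda\times\mu_\Lambda)(W_\sigma)$, and the non-overlap configuration distribution is $\mu^\sigma_{\phi,\Lambda,\tilde\omega_{\Lambda^c}}(\omega)=(\mu_\Lambda\times\mu_\Lambda)\big((\omega,\sigma-\omega)\mid W_\sigma\big)$ (only $\sigma$ with $\rho(\sigma)>0$ are considered). Let $F(s)=\{a\in F:\exists a'\in F,\ a+a'=s\}$. Then $\mu^\sigma$ is a distribution on $\Omega(\sigma)=\prod_{i\in\Lambda}F(\sigma_i)$. For $b\in\mathcal B_\Lambda$ let $\Omega_b(\sigma)=\prod_{i\in b\cap\Lambda}F(\sigma_i)$ (spins outside $\Lambda$ are frozen to the boundary condition), and for $\omega\in\Omega(\sigma)$ identify $\omega_b$ with $\omega_{b\cap\Lambda}\in\Omega_b(\sigma)$. Random cluster representations (RCR). Let $H^\sigma=\prod_{b\in\mathcal B_\Lambda}\mathcal P(\Omega_b(\sigma))$, $\mathcal P$ denoting power set.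 A Bernoulli RCR of $\mu^\sigma$ is given by a product probability measure $\nu^\sigma=\prod_{b\in\mathcal B_\Lambda}\nu^\sigma_b$ on $H^\sigma$ such that for all $\omega\in\Omega(\sigma)$, $\mu^\sigma(\omega)=\frac1{Z_1}\sum_{\eta\in H^\sigma}\nu^\sigma(\eta)\prod_{b\in\mathcal B_\Lambda}\mathbb I_{\omega_b\in\eta_b}$, with $Z_1$ a normalizing constant. For every $\Lambda$ in the sequence and every $\sigma$ a Bernoulli RCR of $\mu^\sigma_{\phi,\Lambda,\tilde\omega_{\Lambda^c}}$ is chosen. The associated random cluster probability is $P^\sigma_{\phi,\Lambda,\tilde\omega_{\Lambda^c}}(\eta)=\frac1{Z_1}\nu^\sigma(\eta)\,|\{\omega\in\Omega(\sigma):\omega_b\in\eta_b\ \forall b\in\mathcal B_\Lambda\}|$. Active hyperbonds. Given $\eta\in H^\sigma$, $b$ is active if $\eta_b\ne\Omega_b(\sigma)$. Let $\mathscr A:H^\sigma\to\{0,1\}^{\mathcal B_\Lambda}$, $\mathscr A(\eta)_b=\mathbb I_{(b\text{ active in }\eta)}$, and let $\mathscr A(P^\sigma)$ be the image measure. The integrated random cluster distribution on active hyperbonds is $\overline P_{\phi,\Lambda,\tilde\omega_{\Lambda^c}}=\sum_{\sigma\in\Sigma}\rho_{\phi,\Lambda,\tilde\omega_{\Lambda^c}}(\sigma)\,\mathscr A(P^\sigma_{\phi,\Lambda,\tilde\omega_{\Lambda^c}})$ on $\{0,1\}^{\mathcal B_\Lambda}$. For sets of vertices $M_1,M_2$, $M_1\xleftrightarrow{act}M_2$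 is the event that there is a chain of active hyperbonds $b_1,\dots,b_m$ ($m\ge1$) with $b_l\cap b_{l+1}\ne\emptyset$ for $1\le l<m$, $b_1\cap M_1\ne\emptyset$ and $b_m\cap M_2\neq\emptyset$.
   Formalization: Two conditions are added, as the claim fails without them: Λ1 contains Λ0, and in the chosen Bernoulli RCR of each μ^σ the probability under ν_b^σ that η_b contains a local configuration ξ is the same for ξ and σ−ξ, for every hyperbond b. *)

theory Defs
  imports "HOL-Probability.Probability"
begin

text \<open>The vertex set is the universe of \<open>'v\<close>. The configuration set of \<open>C\<close> is \<open>C \<rightarrow>\<^sub>E F\<close>,
  so restriction to a subset is \<^const>\<open>restrict\<close> and concatenation is \<^const>\<open>merge\<close>.\<close>

type_synonym 'v config = "'v \<Rightarrow> real"

definition locally_finite_hyperbonds :: "'v set set \<Rightarrow> bool" where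
  "locally_finite_hyperbonds B \<longleftrightarrow> (\<forall>b\<in>B. finite b) \<and> (\<forall>v. finite {b \<in> B. v \<in> b})"

definition hboundary :: "'v set set \<Rightarrow> 'v set \<Rightarrow> 'v set" where
  "hboundary B \<Lambda> = {v. \<exists>b\<in>B. v \<in> b \<and> b \<inter> \<Lambda> \<noteq> {} \<and> b \<inter> - \<Lambda> \<noteq> {}}"

definition touching :: "'v set set \<Rightarrow> 'v set \<Rightarrow> 'v set set" where
  "touching B \<Lambda> = {b \<in> B. b \<inter> \<Lambda> \<noteq> {}}"


subsection \<open>Gibbs measures\<close>

text \<open>The interaction takes the hyperbond as an extra argument, since an extensional function
  need not determine its domain.\<close>

definition is_interaction ::
  "real set \<Rightarrow> 'v set set \<Rightarrow> ('v set \<Rightarrow> 'v config \<Rightarrow> ereal) \<Rightarrow> bool" where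
  "is_interaction F B \<phi> \<longleftrightarrow> (\<forall>b\<in>B. \<forall>\<xi>\<in>b \<rightarrow>\<^sub>E F. \<phi> b \<xi> \<noteq> \<infinity>)"

definition exp_ereal :: "ereal \<Rightarrow> real" where
  "exp_ereal x = (if x = - \<infinity> then 0 else exp (real_of_ereal x))"

definition gibbs_weight ::
  "'v set set \<Rightarrow> ('v set \<Rightarrow> 'v config \<Rightarrow> ereal) \<Rightarrow> 'v set \<Rightarrow> 'v config \<Rightarrow> 'v config \<Rightarrow> real" where
  "gibbs_weight B \<phi> \<Lambda> \<tau> \<omega> = exp_ereal
     ((\<Sum>b\<in>{b \<in> B. b \<subseteq> \<Lambda>}. \<phi> b (restrict \<omega> b))
      + (\<Sum>b\<in>{b \<in> B. b \<inter> \<Lambda> \<noteq> {} \<and> b \<inter> - \<Lambda> \<noteq> {}}. \<phi> b (merge (b \<inter> \<Lambda>) (b \<inter> - \<Lambda>) (\<omega>, \<tau>))))"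

definition partition_function ::
  "real set \<Rightarrow> 'v set set \<Rightarrow> ('v set \<Rightarrow> 'v config \<Rightarrow> ereal) \<Rightarrow> 'v set \<Rightarrow> 'v config \<Rightarrow> real" where
  "partition_function F B \<phi> \<Lambda> \<tau> = (\<Sum>\<omega>\<in>\<Lambda> \<rightarrow>\<^sub>E F. gibbs_weight B \<phi> \<Lambda> \<tau> \<omega>)"

text \<open>Laws on finite sets are given by their mass functions, which are only ever evaluated on
  the set in question.\<close>

definition gibbs ::
  "real set \<Rightarrow> 'v set set \<Rightarrow> ('v set \<Rightarrow> 'v config \<Rightarrow> ereal) \<Rightarrow> 'v set \<Rightarrow> 'v config \<Rightarrow> 'v config \<Rightarrow> real" where
  "gibbs F B \<phi> \<Lambda> \<tau> \<omega> = gibbs_weight B \<phi> \<Lambda> \<tau> \<omega> / partition_function F B \<phi> \<Lambda> \<tau>"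


subsection \<open>Gibbs states, weak convergence, extremality\<close>

definition config_measure :: "real set \<Rightarrow> 'v config measure \<Rightarrow> bool" where
  "config_measure F M \<longleftrightarrow>
     prob_space M \<and> sets M = sets (PiM (UNIV :: 'v set) (\<lambda>_. count_space F))"

definition outside_algebra :: "real set \<Rightarrow> 'v set \<Rightarrow> 'v config measure" where
  "outside_algebra F \<Lambda> =
     vimage_algebra (UNIV \<rightarrow>\<^sub>E F) (\<lambda>x. restrict x (- \<Lambda>)) (PiM (- \<Lambda>) (\<lambda>_. count_space F))"

text \<open>Because of hard constraints the partition function may vanish for some exterior
  configurations; the conditional distribution requires that these form a null set.\<close>

definition gibbs_states ::
  "real set \<Rightarrow> 'v set set \<Rightarrow> ('v set \<Rightarrow> 'v config \<Rightarrow> ereal) \<Rightarrow> 'v config measure set" where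
  "gibbs_states F B \<phi> = {M. config_measure F M \<and>
     (\<forall>\<Lambda>. finite \<Lambda> \<longrightarrow>
        (AE x in M. partition_function F B \<phi> \<Lambda> x > 0) \<and>
        (\<forall>\<xi>\<in>\<Lambda> \<rightarrow>\<^sub>E F. AE x in M.
           real_cond_exp M (outside_algebra F \<Lambda>) (indicator {y. restrict y \<Lambda> = \<xi>}) x
             = gibbs F B \<phi> \<Lambda> x \<xi>))}"

text \<open>Convergence of all events depending on the coordinates in a finite set \<open>C\<close>. Such an event has
  a meaning on the configurations of \<open>\<Lambda> n\<close> as soon as \<open>C \<subseteq> \<Lambda> n\<close>, hence for all large \<open>n\<close> when
  \<open>\<Lambda>\<close> diverges; the earlier terms do not affect the limit.\<close>

definition converges_weakly ::
  "real set \<Rightarrow> (nat \<Rightarrow> 'v set) \<Rightarrow> (nat \<Rightarrow> 'v config \<Rightarrow> real) \<Rightarrow> 'v config measure \<Rightarrow> bool" where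
  "converges_weakly F \<Lambda> m M \<longleftrightarrow>
     (\<forall>C E. finite C \<longrightarrow> E \<subseteq> C \<rightarrow>\<^sub>E F \<longrightarrow>
        (\<lambda>n. \<Sum>\<omega>\<in>{\<omega> \<in> \<Lambda> n \<rightarrow>\<^sub>E F. restrict \<omega> C \<in> E}. m n \<omega>)
          \<longlonglongrightarrow> measure M {x \<in> space M. restrict x C \<in> E})"

text \<open>Measures do not form a real vector space in the library, so \<^const>\<open>extreme_point_of\<close>
  is not applicable.\<close>

definition extremal_in :: "'a measure \<Rightarrow> 'a measure set \<Rightarrow> bool" where
  "extremal_in M K \<longleftrightarrow> M \<in> K \<and>
     (\<forall>M1\<in>K. \<forall>M2\<in>K. \<forall>t::real. 0 < t \<longrightarrow> t < 1 \<longrightarrow>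
        (\<forall>A\<in>sets M. measure M A = t * measure M1 A + (1 - t) * measure M2 A) \<longrightarrow>
        M1 = M \<and> M2 = M)"


subsection \<open>Overlap and non-overlap distributions\<close>

text \<open>In this and the next section \<open>m\<close> is the mass function of the Gibbs measure in \<open>\<Lambda>\<close>.\<close>

definition overlap_alphabet :: "real set \<Rightarrow> real set" where
  "overlap_alphabet F = {a1 + a2 | a1 a2. a1 \<in> F \<and> a2 \<in> F}"

abbreviation overlap_configs :: "real set \<Rightarrow> 'v set \<Rightarrow> 'v config set" where
  "overlap_configs F \<Lambda> \<equiv> \<Lambda> \<rightarrow>\<^sub>E overlap_alphabet F"

definition overlap_pairs :: "real set \<Rightarrow> 'v set \<Rightarrow> 'v config \<Rightarrow> ('v config \<times> 'v config) set" where
  "overlap_pairs F \<Lambda> \<sigma> =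
     {(\<omega>1, \<omega>2). \<omega>1 \<in> \<Lambda> \<rightarrow>\<^sub>E F \<and> \<omega>2 \<in> \<Lambda> \<rightarrow>\<^sub>E F \<and> (\<forall>i\<in>\<Lambda>. \<omega>1 i + \<omega>2 i = \<sigma> i)}"

definition overlap_dist ::
  "real set \<Rightarrow> 'v set \<Rightarrow> ('v config \<Rightarrow> real) \<Rightarrow> 'v config \<Rightarrow> real" where
  "overlap_dist F \<Lambda> m \<sigma> = (\<Sum>(\<omega>1, \<omega>2)\<in>overlap_pairs F \<Lambda> \<sigma>. m \<omega>1 * m \<omega>2)"

definition compl_config :: "'v set \<Rightarrow> 'v config \<Rightarrow> 'v config \<Rightarrow> 'v config" where
  "compl_config C \<sigma> \<omega> = (\<lambda>i\<in>C. \<sigma> i - \<omega> i)"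

definition nonoverlap_dist ::
  "real set \<Rightarrow> 'v set \<Rightarrow> ('v config \<Rightarrow> real) \<Rightarrow> 'v config \<Rightarrow> 'v config \<Rightarrow> real" where
  "nonoverlap_dist F \<Lambda> m \<sigma> \<omega> = m \<omega> * m (compl_config \<Lambda> \<sigma> \<omega>) / overlap_dist F \<Lambda> m \<sigma>"

definition compatible_spins :: "real set \<Rightarrow> real \<Rightarrow> real set" where
  "compatible_spins F s = {a \<in> F. \<exists>a'\<in>F. a + a' = s}"

definition compatible_configs :: "real set \<Rightarrow> 'v config \<Rightarrow> 'v set \<Rightarrow> 'v config set" where
  "compatible_configs F \<sigma> C = (\<Pi>\<^sub>E i\<in>C. compatible_spins F (\<sigma> i))"


subsection \<open>Random cluster representations\<close>

definition rc_configs ::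
  "real set \<Rightarrow> 'v set set \<Rightarrow> 'v set \<Rightarrow> 'v config \<Rightarrow> ('v set \<Rightarrow> 'v config set) set" where
  "rc_configs F B \<Lambda> \<sigma> = (\<Pi>\<^sub>E b\<in>touching B \<Lambda>. Pow (compatible_configs F \<sigma> (b \<inter> \<Lambda>)))"

text \<open>\<open>nu b S\<close> is the probability of the subset \<open>S\<close> under the factor at the hyperbond \<open>b\<close>.\<close>

definition rc_product ::
  "'v set set \<Rightarrow> 'v set \<Rightarrow> ('v set \<Rightarrow> 'v config set \<Rightarrow> real) \<Rightarrow> ('v set \<Rightarrow> 'v config set) \<Rightarrow> real" where
  "rc_product B \<Lambda> nu \<eta> = (\<Prod>b\<in>touching B \<Lambda>. nu b (\<eta> b))"

definition rc_weight ::
  "real set \<Rightarrow> 'v set set \<Rightarrow> 'v set \<Rightarrow> 'v config \<Rightarrow> ('v set \<Rightarrow> 'v config set \<Rightarrow> real)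
     \<Rightarrow> 'v config \<Rightarrow> real" where
  "rc_weight F B \<Lambda> \<sigma> nu \<omega> =
     (\<Sum>\<eta>\<in>rc_configs F B \<Lambda> \<sigma>.
        rc_product B \<Lambda> nu \<eta> * (\<Prod>b\<in>touching B \<Lambda>. of_bool (restrict \<omega> (b \<inter> \<Lambda>) \<in> \<eta> b)))"

definition rc_norm ::
  "real set \<Rightarrow> 'v set set \<Rightarrow> 'v set \<Rightarrow> 'v config \<Rightarrow> ('v set \<Rightarrow> 'v config set \<Rightarrow> real) \<Rightarrow> real" where
  "rc_norm F B \<Lambda> \<sigma> nu = (\<Sum>\<omega>\<in>compatible_configs F \<sigma> \<Lambda>. rc_weight F B \<Lambda> \<sigma> nu \<omega>)"

definition bernoulli_RCR ::
  "real set \<Rightarrow> 'v set set \<Rightarrow> 'v set \<Rightarrow> ('v config \<Rightarrow> real) \<Rightarrow> 'v config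
     \<Rightarrow> ('v set \<Rightarrow> 'v config set \<Rightarrow> real) \<Rightarrow> bool" where
  "bernoulli_RCR F B \<Lambda> m \<sigma> nu \<longleftrightarrow>
     (\<forall>b\<in>touching B \<Lambda>.
        (\<forall>S\<in>Pow (compatible_configs F \<sigma> (b \<inter> \<Lambda>)). nu b S \<ge> 0) \<and>
        (\<Sum>S\<in>Pow (compatible_configs F \<sigma> (b \<inter> \<Lambda>)). nu b S) = 1) \<and>
     (\<forall>\<omega>\<in>compatible_configs F \<sigma> \<Lambda>.
        nonoverlap_dist F \<Lambda> m \<sigma> \<omega> = rc_weight F B \<Lambda> \<sigma> nu \<omega> / rc_norm F B \<Lambda> \<sigma> nu)"

text \<open>The non-overlap distribution is invariant under the exchange of the two copies,
  \<open>\<omega> \<mapsto> \<sigma> - \<omega>\<close>. This requires the same of the probability that a random subset at \<open>b\<close> allows a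
  local configuration \<open>\<xi>\<close>. It holds when these probabilities are proportional to the local
  Gibbs factors \<open>exp (\<phi>(\<xi>) + \<phi>(\<sigma> - \<xi>))\<close>, but it does not follow from \<^const>\<open>bernoulli_RCR\<close>,
  which determines only the product over \<open>b\<close>: for instance, single-site factors may be moved from
  one hyperbond to another.\<close>

definition exchange_symmetric ::
  "real set \<Rightarrow> 'v set set \<Rightarrow> 'v set \<Rightarrow> 'v config \<Rightarrow> ('v set \<Rightarrow> 'v config set \<Rightarrow> real) \<Rightarrow> bool" where
  "exchange_symmetric F B \<Lambda> \<sigma> nu \<longleftrightarrow>
     (\<forall>b\<in>touching B \<Lambda>. \<forall>\<xi>\<in>compatible_configs F \<sigma> (b \<inter> \<Lambda>).
        (\<Sum>S\<in>{S \<in> Pow (compatible_configs F \<sigma> (b \<inter> \<Lambda>)). \<xi> \<in> S}. nu b S)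
        = (\<Sum>S\<in>{S \<in> Pow (compatible_configs F \<sigma> (b \<inter> \<Lambda>)). compl_config (b \<inter> \<Lambda>) \<sigma> \<xi> \<in> S}. nu b S))"

definition rc_prob ::
  "real set \<Rightarrow> 'v set set \<Rightarrow> 'v set \<Rightarrow> 'v config \<Rightarrow> ('v set \<Rightarrow> 'v config set \<Rightarrow> real)
     \<Rightarrow> ('v set \<Rightarrow> 'v config set) \<Rightarrow> real" where
  "rc_prob F B \<Lambda> \<sigma> nu \<eta> =
     rc_product B \<Lambda> nu \<eta>
     * real (card {\<omega> \<in> compatible_configs F \<sigma> \<Lambda>. \<forall>b\<in>touching B \<Lambda>. restrict \<omega> (b \<inter> \<Lambda>) \<in> \<eta> b})
     / rc_norm F B \<Lambda> \<sigma> nu"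


subsection \<open>Active hyperbonds\<close>

text \<open>An element of \<open>{0,1}\<close> to the power \<open>touching B \<Lambda>\<close> is identified with the set of
  hyperbonds at which it takes the value 1.\<close>

definition active_set ::
  "real set \<Rightarrow> 'v set set \<Rightarrow> 'v set \<Rightarrow> 'v config \<Rightarrow> ('v set \<Rightarrow> 'v config set) \<Rightarrow> 'v set set" where
  "active_set F B \<Lambda> \<sigma> \<eta> = {b \<in> touching B \<Lambda>. \<eta> b \<noteq> compatible_configs F \<sigma> (b \<inter> \<Lambda>)}"

definition active_dist ::
  "real set \<Rightarrow> 'v set set \<Rightarrow> 'v set \<Rightarrow> 'v config \<Rightarrow> ('v set \<Rightarrow> 'v config set \<Rightarrow> real)
     \<Rightarrow> 'v set set \<Rightarrow> real" where
  "active_dist F B \<Lambda> \<sigma> nu \<alpha> =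
     (\<Sum>\<eta>\<in>{\<eta> \<in> rc_configs F B \<Lambda> \<sigma>. active_set F B \<Lambda> \<sigma> \<eta> = \<alpha>}. rc_prob F B \<Lambda> \<sigma> nu \<eta>)"

definition integrated_active_dist ::
  "real set \<Rightarrow> 'v set set \<Rightarrow> 'v set \<Rightarrow> ('v config \<Rightarrow> real)
     \<Rightarrow> ('v config \<Rightarrow> 'v set \<Rightarrow> 'v config set \<Rightarrow> real) \<Rightarrow> 'v set set \<Rightarrow> real" where
  "integrated_active_dist F B \<Lambda> m nu \<alpha> =
     (\<Sum>\<sigma>\<in>overlap_configs F \<Lambda>. overlap_dist F \<Lambda> m \<sigma> * active_dist F B \<Lambda> \<sigma> (nu \<sigma>) \<alpha>)"

definition connected_by :: "'v set set \<Rightarrow> 'v set \<Rightarrow> 'v set \<Rightarrow> bool" where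
  "connected_by \<alpha> M1 M2 \<longleftrightarrow>
     (\<exists>bs. bs \<noteq> [] \<and> set bs \<subseteq> \<alpha> \<and> (\<forall>l. Suc l < length bs \<longrightarrow> bs ! l \<inter> bs ! Suc l \<noteq> {}) \<and>
           hd bs \<inter> M1 \<noteq> {} \<and> last bs \<inter> M2 \<noteq> {})"

definition rc_connection_prob ::
  "real set \<Rightarrow> 'v set set \<Rightarrow> 'v set \<Rightarrow> 'v config \<Rightarrow> ('v set \<Rightarrow> 'v config set \<Rightarrow> real)
     \<Rightarrow> 'v set \<Rightarrow> 'v set \<Rightarrow> real" where
  "rc_connection_prob F B \<Lambda> \<sigma> nu M1 M2 =
     (\<Sum>\<eta>\<in>{\<eta> \<in> rc_configs F B \<Lambda> \<sigma>. connected_by (active_set F B \<Lambda> \<sigma> \<eta>) M1 M2}.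
        rc_prob F B \<Lambda> \<sigma> nu \<eta>)"

definition integrated_connection_prob ::
  "real set \<Rightarrow> 'v set set \<Rightarrow> 'v set \<Rightarrow> ('v config \<Rightarrow> real)
     \<Rightarrow> ('v config \<Rightarrow> 'v set \<Rightarrow> 'v config set \<Rightarrow> real) \<Rightarrow> 'v set \<Rightarrow> 'v set \<Rightarrow> real" where
  "integrated_connection_prob F B \<Lambda> m nu M1 M2 =
     (\<Sum>\<alpha>\<in>{\<alpha> \<in> Pow (touching B \<Lambda>). connected_by \<alpha> M1 M2}. integrated_active_dist F B \<Lambda> m nu \<alpha>)"

end

theory Submission
  imports Defs
begin

text \<open>
  Weak limits of finite volume Gibbs measures are Gibbs states because the hyperbonds are locally
  finite: the conditional law in \<open>\<Delta>\<close> given the outside depends on the finitely many sites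
  of \<open>outer_nbhd B \<Delta>\<close> only, so the consistency relations of the finite volume measures
  (\<open>gibbs_consistent\<close>) are identities between probabilities of local events and survive the
  limit. The lemma \<open>gibbs_states_iff_local_DLR\<close> says that these local identities are
  equivalent to the description by conditional expectations.

  Extremality comes from decay of correlations. Take two independent copies \<open>\<omega>1\<close>, \<open>\<omega>2\<close>
  of the finite volume measure and condition on their sum \<open>\<sigma>\<close>, so that
  \<open>\<omega>2 = \<sigma> - \<omega>1\<close>. In the random cluster representation given \<open>\<sigma>\<close>, an
  inactive hyperbond imposes nothing on \<open>\<omega>1\<close>, and by exchange symmetry the weight of an
  active one, summed over the subsets that make it active, is unchanged when \<open>\<omega>1\<close> is replaced
  by \<open>\<sigma> - \<omega>1\<close> on the whole hyperbond. Hence, given the active set, exchanging the two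
  copies on a union of active clusters preserves the law of \<open>\<omega>1\<close>
  (\<open>sum_rc_joint_swap_on\<close>). Apply this to the cluster of \<open>\<Lambda>0\<close>. As long as it is not connected to the boundary of
  \<open>\<Lambda>1\<close> it stays inside \<open>\<Lambda>1\<close>, so for \<open>P\<close> living on \<open>\<Lambda>0\<close> and \<open>Q\<close>
  living outside \<open>\<Lambda>1\<close> the exchange turns the event \<open>P \<omega>1 \<and> Q \<omega>1\<close> into
  \<open>P \<omega>2 \<and> Q \<omega>1\<close>, whose probability factorizes. The covariance of \<open>P\<close> and \<open>Q\<close> is
  therefore bounded by the connection probability (\<open>finite_volume_correlation_bound\<close>), with a
  bound that is uniform in \<open>Q\<close> and passes to the limit \<open>M\<close>.

  Finally let \<open>M = t M1 + (1 - t) M2\<close> with Gibbs states \<open>M1\<close>, \<open>M2\<close>. For a local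
  event \<open>P\<close> and a large finite \<open>\<Delta>\<close>, the conditional probability of \<open>P\<close> given the outside of \<open>\<Delta>\<close> is the same function \<open>\<gamma>\<close> for all three
  measures, and small correlations with the outside mean that \<open>\<gamma>\<close> is close to the constant
  \<open>M(P)\<close> in \<open>L1(M)\<close>. Since \<open>M1 \<le> M / t\<close>, it is also close to it in \<open>L1(M1)\<close>, so
  that \<open>M1(P)\<close>, being the \<open>M1\<close>-mean of \<open>\<gamma>\<close>, is close to \<open>M(P)\<close>. As \<open>\<gamma>\<close> takes
  finitely many values, this argument (\<open>extremal_if_short_range_correlations\<close>) requires neither
  densities nor the tail field.
\<close>

section \<open>Configurations and local events\<close>

lemma sum_configs_split:
  assumes "\<Delta> \<subseteq> \<Lambda>"
  shows "(\<Sum>\<omega>\<in>\<Lambda> \<rightarrow>\<^sub>E F. f \<omega>) = (\<Sum>\<zeta>\<in>(\<Lambda> - \<Delta>) \<rightarrow>\<^sub>E F. \<Sum>\<xi>\<in>\<Delta> \<rightarrow>\<^sub>E F. f (merge \<Delta> (\<Lambda> - \<Delta>) (\<xi>, \<zeta>)))"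
proof -
  have "(\<Sum>\<omega>\<in>\<Lambda> \<rightarrow>\<^sub>E F. f \<omega>)
      = (\<Sum>(\<zeta>, \<xi>)\<in>((\<Lambda> - \<Delta>) \<rightarrow>\<^sub>E F) \<times> (\<Delta> \<rightarrow>\<^sub>E F). f (merge \<Delta> (\<Lambda> - \<Delta>) (\<xi>, \<zeta>)))"
    using assms
    by (intro sum.reindex_bij_witness[of _ "\<lambda>(\<zeta>, \<xi>). merge \<Delta> (\<Lambda> - \<Delta>) (\<xi>, \<zeta>)"
          "\<lambda>\<omega>. (restrict \<omega> (\<Lambda> - \<Delta>), restrict \<omega> \<Delta>)"])
      (auto simp: merge_def PiE_iff extensional_def restrict_def fun_eq_iff intro!: arg_cong[of _ _ f])
  then show ?thesis by (simp add: sum.cartesian_product)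
qed

definition local_event :: "'v set \<Rightarrow> ('v config \<Rightarrow> bool) \<Rightarrow> bool" where
  "local_event C P \<longleftrightarrow> (\<forall>x y. (\<forall>i\<in>C. x i = y i) \<longrightarrow> P x = P y)"

lemma local_eventD: "local_event C P \<Longrightarrow> (\<And>i. i \<in> C \<Longrightarrow> x i = y i) \<Longrightarrow> P x = P y"
  by (auto simp: local_event_def)

lemma local_event_restrict: "local_event C (\<lambda>x. restrict x C \<in> E)"
proof -
  have "restrict x C = restrict y C" if "\<forall>i\<in>C. x i = y i" for x y :: "'a config"
    using that by (auto simp: restrict_def)
  then show ?thesis unfolding local_event_def by metis
qed

lemma local_event_conj:
  "local_event C P \<Longrightarrow> local_event D Q \<Longrightarrow> local_event (C \<union> D) (\<lambda>x. P x \<and> Q x)"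
  unfolding local_event_def by (metis UnCI)

section \<open>Consistency of finite volume Gibbs measures\<close>

definition bond_factor :: "('v set \<Rightarrow> 'v config \<Rightarrow> ereal) \<Rightarrow> 'v set \<Rightarrow> 'v config \<Rightarrow> real" where
  "bond_factor \<phi> b x = exp_ereal (\<phi> b (restrict x b))"

text \<open>The empty hyperbond, if present, contributes a constant factor to every volume; it is kept here so
  that the weight is exactly a product over this set.\<close>

definition energy_bonds :: "'v set set \<Rightarrow> 'v set \<Rightarrow> 'v set set" where
  "energy_bonds B \<Lambda> = {b \<in> B. b \<subseteq> \<Lambda> \<or> b \<inter> \<Lambda> \<noteq> {}}"

definition outer_nbhd :: "'v set set \<Rightarrow> 'v set \<Rightarrow> 'v set" where
  "outer_nbhd B \<Lambda> = \<Union> (touching B \<Lambda>) - \<Lambda>"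

lemma finite_touching:
  assumes "locally_finite_hyperbonds B" "finite \<Lambda>"
  shows "finite (touching B \<Lambda>)"
proof -
  have "touching B \<Lambda> = (\<Union>v\<in>\<Lambda>. {b \<in> B. v \<in> b})" by (auto simp: touching_def)
  then show ?thesis using assms by (simp add: locally_finite_hyperbonds_def)
qed

lemma finite_energy_bonds:
  assumes "locally_finite_hyperbonds B" "finite \<Lambda>"
  shows "finite (energy_bonds B \<Lambda>)"
proof -
  have "energy_bonds B \<Lambda> \<subseteq> insert {} (touching B \<Lambda>)"
    by (auto simp: touching_def energy_bonds_def)
  then show ?thesis using finite_touching[OF assms] by (meson finite_insert finite_subset)
qed

lemma finite_outer_nbhd:
  assumes "locally_finite_hyperbonds B" "finite \<Lambda>"
  shows "finite (outer_nbhd B \<Lambda>)"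
  using finite_touching[OF assms] assms(1)
  by (auto simp: outer_nbhd_def touching_def locally_finite_hyperbonds_def)

lemma exp_ereal_nonneg: "exp_ereal x \<ge> 0"
  by (simp add: exp_ereal_def)

text \<open>The absence of \<open>\<infinity>\<close> is carried through the induction because
  \<open>\<infinity> + (- \<infinity>)\<close> would break the homomorphism property.\<close>

lemma exp_ereal_sum:
  assumes "finite I" "\<And>i. i \<in> I \<Longrightarrow> f i \<noteq> \<infinity>"
  shows "exp_ereal (\<Sum>i\<in>I. f i) = (\<Prod>i\<in>I. exp_ereal (f i)) \<and> (\<Sum>i\<in>I. f i) \<noteq> \<infinity>"
  using assms
proof (induction I rule: finite_induct)
  case empty
  then show ?case by (simp add: exp_ereal_def)
next
  case (insert a I)
  moreover have "exp_ereal (u + v) = exp_ereal u * exp_ereal v" if "u \<noteq> \<infinity>" "v \<noteq> \<infinity>" for u v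
    using that by (cases u; cases v) (auto simp: exp_ereal_def exp_add)
  ultimately show ?case by (auto simp: sum.insert)
qed

lemma gibbs_weight_nonneg: "gibbs_weight B \<phi> \<Lambda> \<tau> \<omega> \<ge> 0"
  by (simp add: gibbs_weight_def exp_ereal_nonneg)

lemma partition_function_nonneg: "partition_function F B \<phi> \<Lambda> \<tau> \<ge> 0"
  by (simp add: partition_function_def gibbs_weight_nonneg sum_nonneg)

lemma gibbs_nonneg: "gibbs F B \<phi> \<Lambda> \<tau> \<omega> \<ge> 0"
  by (simp add: gibbs_def gibbs_weight_nonneg partition_function_nonneg)

lemma sum_gibbs:
  "partition_function F B \<phi> \<Lambda> \<tau> > 0 \<Longrightarrow> (\<Sum>\<omega>\<in>\<Lambda> \<rightarrow>\<^sub>E F. gibbs F B \<phi> \<Lambda> \<tau> \<omega>) = 1"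
  by (simp add: gibbs_def partition_function_def flip: sum_divide_distrib)

lemma gibbs_weight_eq_prod:
  assumes "is_interaction F B \<phi>" "locally_finite_hyperbonds B" "finite \<Lambda>"
    and "\<And>i. override_on \<tau> \<omega> \<Lambda> i \<in> F"
  shows "gibbs_weight B \<phi> \<Lambda> \<tau> \<omega> = (\<Prod>b\<in>energy_bonds B \<Lambda>. bond_factor \<phi> b (override_on \<tau> \<omega> \<Lambda>))"
proof -
  let ?x = "override_on \<tau> \<omega> \<Lambda>"
  let ?I = "{b \<in> B. b \<subseteq> \<Lambda>}" and ?J = "{b \<in> B. b \<inter> \<Lambda> \<noteq> {} \<and> b \<inter> - \<Lambda> \<noteq> {}}"
  have split: "energy_bonds B \<Lambda> = ?I \<union> ?J" "?I \<inter> ?J = {}" by (auto simp: energy_bonds_def)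
  have fin: "finite ?I" "finite ?J" using finite_energy_bonds[OF assms(2,3)] split(1) by auto
  have "(\<Sum>b\<in>?I. \<phi> b (restrict \<omega> b)) = (\<Sum>b\<in>?I. \<phi> b (restrict ?x b))"
    by (intro sum.cong refl arg_cong[of _ _ "\<phi> _"]) (auto simp: restrict_def override_on_def fun_eq_iff)
  moreover have "(\<Sum>b\<in>?J. \<phi> b (merge (b \<inter> \<Lambda>) (b \<inter> - \<Lambda>) (\<omega>, \<tau>))) = (\<Sum>b\<in>?J. \<phi> b (restrict ?x b))"
    by (intro sum.cong refl arg_cong[of _ _ "\<phi> _"]) (auto simp: restrict_def override_on_def merge_def)
  ultimately have "gibbs_weight B \<phi> \<Lambda> \<tau> \<omega> = exp_ereal (\<Sum>b\<in>energy_bonds B \<Lambda>. \<phi> b (restrict ?x b))"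
    unfolding gibbs_weight_def split(1) using fin split(2) by (simp add: sum.union_disjoint)
  moreover have "\<phi> b (restrict ?x b) \<noteq> \<infinity>" if "b \<in> energy_bonds B \<Lambda>" for b
    using assms(1,4) that by (auto simp: is_interaction_def energy_bonds_def)
  ultimately show ?thesis
    using exp_ereal_sum[OF finite_energy_bonds[OF assms(2,3)]] by (simp add: bond_factor_def)
qed

lemma gibbs_weight_cong:
  assumes "\<And>i. i \<in> \<Lambda> \<Longrightarrow> \<omega> i = \<omega>' i" "\<And>i. i \<in> outer_nbhd B \<Lambda> \<Longrightarrow> \<tau> i = \<tau>' i"
  shows "gibbs_weight B \<phi> \<Lambda> \<tau> \<omega> = gibbs_weight B \<phi> \<Lambda> \<tau>' \<omega>'"
proof -
  have "(\<Sum>b\<in>{b \<in> B. b \<subseteq> \<Lambda>}. \<phi> b (restrict \<omega> b)) = (\<Sum>b\<in>{b \<in> B. b \<subseteq> \<Lambda>}. \<phi> b (restrict \<omega>' b))"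
    using assms(1) by (intro sum.cong refl arg_cong[of _ _ "\<phi> _"]) (auto simp: restrict_def fun_eq_iff)
  moreover {have "merge (b \<inter> \<Lambda>) (b \<inter> - \<Lambda>) (\<omega>, \<tau>) = merge (b \<inter> \<Lambda>) (b \<inter> - \<Lambda>) (\<omega>', \<tau>')"
    if "b \<in> {b \<in> B. b \<inter> \<Lambda> \<noteq> {} \<and> b \<inter> - \<Lambda> \<noteq> {}}" for b
    using that assms by (force simp: merge_def outer_nbhd_def touching_def)
  then have "(\<Sum>b\<in>{b \<in> B. b \<inter> \<Lambda> \<noteq> {} \<and> b \<inter> - \<Lambda> \<noteq> {}}. \<phi> b (merge (b \<inter> \<Lambda>) (b \<inter> - \<Lambda>) (\<omega>, \<tau>)))
      = (\<Sum>b\<in>{b \<in> B. b \<inter> \<Lambda> \<noteq> {} \<and> b \<inter> - \<Lambda> \<noteq> {}}. \<phi> b (merge (b \<inter> \<Lambda>) (b \<inter> - \<Lambda>) (\<omega>', \<tau>')))"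
    by (intro sum.cong refl) simp}
  ultimately show ?thesis by (simp add: gibbs_weight_def)
qed

lemma gibbs_cong:
  assumes "\<And>i. i \<in> outer_nbhd B \<Lambda> \<Longrightarrow> \<tau> i = \<tau>' i"
  shows "gibbs F B \<phi> \<Lambda> \<tau> = gibbs F B \<phi> \<Lambda> \<tau>'"
    and "partition_function F B \<phi> \<Lambda> \<tau> = partition_function F B \<phi> \<Lambda> \<tau>'"
proof -
  have "gibbs_weight B \<phi> \<Lambda> \<tau> = gibbs_weight B \<phi> \<Lambda> \<tau>'"
    using assms by (intro ext gibbs_weight_cong) auto
  then show "gibbs F B \<phi> \<Lambda> \<tau> = gibbs F B \<phi> \<Lambda> \<tau>'"
    and "partition_function F B \<phi> \<Lambda> \<tau> = partition_function F B \<phi> \<Lambda> \<tau>'"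
    by (simp_all add: gibbs_def partition_function_def fun_eq_iff)
qed

text \<open>Hyperbonds that touch \<open>\<Delta>\<close> are accounted for by the weight of
  \<open>\<Delta>\<close> with the surrounding configuration as boundary condition; the remaining factors do
  not see \<open>\<Delta>\<close>.\<close>

lemma gibbs_weight_factor:
  assumes "is_interaction F B \<phi>" "locally_finite_hyperbonds B" "finite \<Lambda>" "\<Delta> \<subseteq> \<Lambda>"
    and F: "\<And>i. override_on \<tau> \<omega> \<Lambda> i \<in> F"
  shows "gibbs_weight B \<phi> \<Lambda> \<tau> \<omega> = gibbs_weight B \<phi> \<Delta> (override_on \<tau> \<omega> \<Lambda>) \<omega>
    * (\<Prod>b\<in>energy_bonds B \<Lambda> - energy_bonds B \<Delta>. bond_factor \<phi> b (override_on \<tau> \<omega> \<Lambda>))"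
proof -
  have eq: "override_on (override_on \<tau> \<omega> \<Lambda>) \<omega> \<Delta> = override_on \<tau> \<omega> \<Lambda>"
    using assms(4) by (auto simp: override_on_def fun_eq_iff)
  have sub: "energy_bonds B \<Delta> \<subseteq> energy_bonds B \<Lambda>"
    using assms(4) by (auto simp: energy_bonds_def)
  have "finite \<Delta>" using assms(3,4) finite_subset by blast
  then show ?thesis
    using gibbs_weight_eq_prod[OF assms(1,2) \<open>finite \<Delta>\<close>, of "override_on \<tau> \<omega> \<Lambda>" \<omega>]
      gibbs_weight_eq_prod[OF assms(1-3) F] F
      prod.subset_diff[OF sub finite_energy_bonds[OF assms(2,3)], of "\<lambda>b. bond_factor \<phi> b (override_on \<tau> \<omega> \<Lambda>)"]
    by (simp add: eq mult.commute)
qed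

text \<open>Summing the factorized weight over the spins of \<open>\<Lambda>\<close> outside \<open>\<Delta>
  \<union> C\<close> gives the same factor for every configuration in \<open>\<Delta>\<close>, since
  \<open>C\<close> screens \<open>\<Delta>\<close> from these spins. Boundary values with vanishing partition
  function cause no exception: all weights in \<open>\<Delta>\<close> vanish too, and both sides are
  zero.\<close>

lemma gibbs_consistent:
  assumes "finite F" "is_interaction F B \<phi>" "locally_finite_hyperbonds B" "finite \<Lambda>"
    and "\<Delta> \<subseteq> \<Lambda>" "C \<subseteq> \<Lambda>" "C \<inter> \<Delta> = {}" "outer_nbhd B \<Delta> \<subseteq> C"
    and \<tau>: "\<tau> \<in> - \<Lambda> \<rightarrow> F" and \<xi>: "\<xi> \<in> \<Delta> \<rightarrow>\<^sub>E F"
  shows "(\<Sum>\<omega>\<in>{\<omega> \<in> \<Lambda> \<rightarrow>\<^sub>E F. restrict \<omega> \<Delta> = \<xi> \<and> restrict \<omega> C = y}. gibbs F B \<phi> \<Lambda> \<tau> \<omega>)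
    = gibbs F B \<phi> \<Delta> y \<xi> * (\<Sum>\<omega>\<in>{\<omega> \<in> \<Lambda> \<rightarrow>\<^sub>E F. restrict \<omega> C = y}. gibbs F B \<phi> \<Lambda> \<tau> \<omega>)"
proof -
  let ?m = "\<lambda>\<zeta> \<xi>'. merge \<Delta> (\<Lambda> - \<Delta>) (\<xi>', \<zeta>) :: 'a config"
  define r where "r \<omega> = (\<Prod>b\<in>energy_bonds B \<Lambda> - energy_bonds B \<Delta>. bond_factor \<phi> b (override_on \<tau> \<omega> \<Lambda>))" for \<omega>
  define Y where "Y = {\<zeta> \<in> (\<Lambda> - \<Delta>) \<rightarrow>\<^sub>E F. restrict \<zeta> C = y}"
  let ?W = "\<lambda>\<xi>'. gibbs_weight B \<phi> \<Delta> y \<xi>'"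
  have finP: "finite (A \<rightarrow>\<^sub>E F)" if "A \<subseteq> \<Lambda>" for A
    using that assms(1,4) by (intro finite_PiE) (auto intro: finite_subset)
  have fact: "gibbs_weight B \<phi> \<Lambda> \<tau> (?m \<zeta> \<xi>') = ?W \<xi>' * r \<zeta>"
    if \<zeta>: "\<zeta> \<in> Y" and \<xi>': "\<xi>' \<in> \<Delta> \<rightarrow>\<^sub>E F" for \<zeta> \<xi>'
  proof -
    have "override_on \<tau> (?m \<zeta> \<xi>') \<Lambda> i \<in> F" for i
      using \<tau> \<zeta> \<xi>' assms(5) by (auto simp: override_on_def merge_def Y_def PiE_iff Pi_iff)
    note gibbs_weight_factor[OF assms(2-5) this]
    moreover have "r (?m \<zeta> \<xi>') = r \<zeta>"
      unfolding r_def bond_factor_def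
      by (intro prod.cong refl arg_cong[of _ _ exp_ereal] arg_cong[of _ _ "\<phi> _"])
        (auto simp: restrict_def fun_eq_iff override_on_def merge_def energy_bonds_def)
    moreover have "gibbs_weight B \<phi> \<Delta> (override_on \<tau> (?m \<zeta> \<xi>') \<Lambda>) (?m \<zeta> \<xi>') = ?W \<xi>'"
    proof (rule gibbs_weight_cong)
      fix i assume "i \<in> outer_nbhd B \<Delta>"
      then have "i \<in> C" using assms(8) by auto
      moreover from this have "\<zeta> i = y i" using \<zeta> by (auto simp: Y_def)
      ultimately show "override_on \<tau> (?m \<zeta> \<xi>') \<Lambda> i = y i"
        using assms(6,7) by (auto simp: override_on_def merge_def)
    qed (auto simp: merge_def)
    ultimately show ?thesis by (simp add: r_def)
  qed
  have resC: "restrict (?m \<zeta> \<xi>') C = restrict \<zeta> C" for \<zeta> \<xi>'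
    using assms(6,7) by (auto simp: restrict_def merge_def fun_eq_iff)
  have res\<Delta>: "restrict (?m \<zeta> \<xi>') \<Delta> = \<xi>'" if "\<xi>' \<in> \<Delta> \<rightarrow>\<^sub>E F" for \<zeta> \<xi>'
    using that by (auto simp: restrict_def merge_def fun_eq_iff PiE_iff extensional_def)
  have split: "(\<Sum>\<omega>\<in>{\<omega> \<in> \<Lambda> \<rightarrow>\<^sub>E F. Q (restrict \<omega> \<Delta>) \<and> restrict \<omega> C = y}. gibbs_weight B \<phi> \<Lambda> \<tau> \<omega>)
      = (\<Sum>\<xi>'\<in>{\<xi>' \<in> \<Delta> \<rightarrow>\<^sub>E F. Q \<xi>'}. ?W \<xi>') * (\<Sum>\<zeta>\<in>Y. r \<zeta>)" for Q
  proof -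
    have "(\<Sum>\<omega>\<in>{\<omega> \<in> \<Lambda> \<rightarrow>\<^sub>E F. Q (restrict \<omega> \<Delta>) \<and> restrict \<omega> C = y}. gibbs_weight B \<phi> \<Lambda> \<tau> \<omega>)
      = (\<Sum>\<omega>\<in>\<Lambda> \<rightarrow>\<^sub>E F. if Q (restrict \<omega> \<Delta>) \<and> restrict \<omega> C = y then gibbs_weight B \<phi> \<Lambda> \<tau> \<omega> else 0)"
      using finP by (subst sum.inter_filter) auto
    also have "\<dots> = (\<Sum>\<zeta>\<in>(\<Lambda> - \<Delta>) \<rightarrow>\<^sub>E F. if restrict \<zeta> C = y then
        \<Sum>\<xi>'\<in>\<Delta> \<rightarrow>\<^sub>E F. if Q \<xi>' then gibbs_weight B \<phi> \<Lambda> \<tau> (?m \<zeta> \<xi>') else 0 else 0)"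
      unfolding sum_configs_split[OF assms(5)]
      by (intro sum.cong refl) (auto simp: resC res\<Delta> intro!: sum.cong)
    also have "\<dots> = (\<Sum>\<zeta>\<in>Y. \<Sum>\<xi>'\<in>{\<xi>' \<in> \<Delta> \<rightarrow>\<^sub>E F. Q \<xi>'}. gibbs_weight B \<phi> \<Lambda> \<tau> (?m \<zeta> \<xi>'))"
      unfolding Y_def using finP assms(5) by (simp add: sum.inter_filter)
    also have "\<dots> = (\<Sum>\<zeta>\<in>Y. \<Sum>\<xi>'\<in>{\<xi>' \<in> \<Delta> \<rightarrow>\<^sub>E F. Q \<xi>'}. ?W \<xi>' * r \<zeta>)"
      by (intro sum.cong refl) (auto simp: fact)
    finally show ?thesis by (subst (asm) sum.swap) (simp add: sum_product)
  qed
  have "{\<xi>' \<in> \<Delta> \<rightarrow>\<^sub>E F. \<xi>' = \<xi>} = {\<xi>}" using \<xi> by auto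
  then have 1: "(\<Sum>\<omega>\<in>{\<omega> \<in> \<Lambda> \<rightarrow>\<^sub>E F. restrict \<omega> \<Delta> = \<xi> \<and> restrict \<omega> C = y}. gibbs_weight B \<phi> \<Lambda> \<tau> \<omega>)
      = ?W \<xi> * (\<Sum>\<zeta>\<in>Y. r \<zeta>)"
    using split[of "\<lambda>z. z = \<xi>"] by simp
  have 2: "(\<Sum>\<omega>\<in>{\<omega> \<in> \<Lambda> \<rightarrow>\<^sub>E F. restrict \<omega> C = y}. gibbs_weight B \<phi> \<Lambda> \<tau> \<omega>)
      = partition_function F B \<phi> \<Delta> y * (\<Sum>\<zeta>\<in>Y. r \<zeta>)"
    using split[of "\<lambda>z. True"] by (simp add: partition_function_def)
  have 3: "?W \<xi> = gibbs F B \<phi> \<Delta> y \<xi> * partition_function F B \<phi> \<Delta> y"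
  proof (cases "partition_function F B \<phi> \<Delta> y = 0")
    case True
    then have "?W \<xi> = 0"
      using \<xi> finP[OF assms(5)] by (simp add: partition_function_def sum_nonneg_eq_0_iff gibbs_weight_nonneg)
    then show ?thesis using True by simp
  qed (simp add: gibbs_def)
  show ?thesis
    using 1 2 3 by (simp add: gibbs_def[of F B \<phi> \<Lambda>] flip: sum_divide_distrib)
qed

section \<open>Measures on configurations\<close>

lemma space_config_measure: "config_measure F M \<Longrightarrow> space M = UNIV \<rightarrow>\<^sub>E F"
  unfolding config_measure_def using sets_eq_imp_space_eq[of M] by (auto simp: space_PiM)

lemma prob_space_config_measure: "config_measure F M \<Longrightarrow> prob_space M"
  by (simp add: config_measure_def)

lemma measurable_restrict_config:
  assumes "config_measure F M" "finite F" "finite C"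
  shows "(\<lambda>x. restrict x C) \<in> measurable M (count_space (C \<rightarrow>\<^sub>E F))"
proof -
  have "PiM C (\<lambda>_. count_space F) = count_space (C \<rightarrow>\<^sub>E F)"
    using assms(2,3) by (intro count_space_PiM_finite) (auto intro: countable_finite)
  moreover have "(\<lambda>x. restrict x C) \<in> measurable (PiM UNIV (\<lambda>_. count_space F)) (PiM C (\<lambda>_. count_space F))"
    by (rule measurable_restrict_subset) simp
  moreover have "sets M = sets (PiM UNIV (\<lambda>_. count_space F))"
    using assms(1) by (simp add: config_measure_def)
  ultimately show ?thesis by (metis measurable_cong_sets)
qed

lemma measurable_restrict_outside_algebra:
  assumes "finite F" "finite C" "C \<inter> \<Delta> = {}"
  shows "(\<lambda>x. restrict x C) \<in> measurable (outside_algebra F \<Delta>) (count_space (C \<rightarrow>\<^sub>E F))"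
proof -
  have eq: "PiM C (\<lambda>_. count_space F) = count_space (C \<rightarrow>\<^sub>E F)"
    using assms by (intro count_space_PiM_finite) (auto intro: countable_finite)
  have "(\<lambda>x. restrict x C) \<in> measurable (PiM (- \<Delta>) (\<lambda>_. count_space F)) (count_space (C \<rightarrow>\<^sub>E F))"
    unfolding eq[symmetric] using assms(3) by (intro measurable_restrict_subset) auto
  moreover have "(\<lambda>x. restrict x (- \<Delta>)) \<in> measurable (outside_algebra F \<Delta>) (PiM (- \<Delta>) (\<lambda>_. count_space F))"
    unfolding outside_algebra_def by (rule measurable_vimage_algebra1) (auto simp: space_PiM)
  ultimately have "(\<lambda>x. restrict (restrict x (- \<Delta>)) C) \<in> measurable (outside_algebra F \<Delta>) (count_space (C \<rightarrow>\<^sub>E F))"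
    by (rule measurable_compose[rotated])
  moreover have "restrict (restrict x (- \<Delta>)) C = restrict x C" for x :: "'a config"
    using assms(3) by (auto simp: restrict_def fun_eq_iff)
  ultimately show ?thesis by simp
qed

lemma local_event_restrict_iff: "local_event C P \<Longrightarrow> P (restrict x C) = P x"
  by (simp add: local_event_def)

lemma local_event_sets:
  assumes "config_measure F M" "finite F" "finite C" "local_event C P"
  shows "{x \<in> space M. P x} \<in> sets M"
proof -
  have "{x \<in> space M. P x} = (\<lambda>x. restrict x C) -` {z \<in> C \<rightarrow>\<^sub>E F. P z} \<inter> space M"
    using space_config_measure[OF assms(1)] local_event_restrict_iff[OF assms(4)] by (auto simp: PiE_iff)
  then show ?thesis
    using measurable_sets[OF measurable_restrict_config[OF assms(1-3)], of "{z \<in> C \<rightarrow>\<^sub>E F. P z}"] by auto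
qed

lemma local_event_eq: "C \<subseteq> D \<Longrightarrow> local_event D (\<lambda>x. restrict x C = y)"
  unfolding local_event_def
proof (intro allI impI)
  fix x z :: "'a config" assume "C \<subseteq> D" "\<forall>i\<in>D. x i = z i"
  then have "restrict x C = restrict z C" by (auto simp: restrict_def fun_eq_iff)
  then show "(restrict x C = y) = (restrict z C = y)" by simp
qed

lemma local_event_mono: "C \<subseteq> D \<Longrightarrow> local_event C P \<Longrightarrow> local_event D P"
  unfolding local_event_def by (meson subsetD)

lemma prob_split_local:
  assumes "config_measure F M" "finite F" "finite C" "finite D" "local_event D P"
  shows "\<P>(x in M. P x) = (\<Sum>y\<in>C \<rightarrow>\<^sub>E F. \<P>(x in M. P x \<and> restrict x C = y))"
proof -
  interpret prob_space M by (rule prob_space_config_measure[OF assms(1)])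
  have "{x \<in> space M. P x} = (\<Union>y\<in>C \<rightarrow>\<^sub>E F. {x \<in> space M. P x \<and> restrict x C = y})"
    using space_config_measure[OF assms(1)] by (auto simp: PiE_iff)
  moreover have "measure M (\<Union>y\<in>C \<rightarrow>\<^sub>E F. {x \<in> space M. P x \<and> restrict x C = y})
      = (\<Sum>y\<in>C \<rightarrow>\<^sub>E F. \<P>(x in M. P x \<and> restrict x C = y))"
  proof (rule finite_measure_finite_Union)
    show "finite (C \<rightarrow>\<^sub>E F)" using assms by (intro finite_PiE) auto
    have "{x \<in> space M. P x \<and> restrict x C = y} \<in> sets M" for y
      using assms by (intro local_event_sets[of F M "D \<union> C"] local_event_conj local_event_eq) auto
    then show "(\<lambda>y. {x \<in> space M. P x \<and> restrict x C = y}) ` (C \<rightarrow>\<^sub>E F) \<subseteq> sets M" by auto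
    show "disjoint_family_on (\<lambda>y. {x \<in> space M. P x \<and> restrict x C = y}) (C \<rightarrow>\<^sub>E F)"
      by (auto simp: disjoint_family_on_def)
  qed
  ultimately show ?thesis by simp
qed

text \<open>Local events contain the finite-dimensional cylinders, which form an intersection-stable
  generator.\<close>

lemma config_measure_eqI:
  assumes "config_measure F M" "config_measure F N" "finite F"
    and eq: "\<And>C P. finite C \<Longrightarrow> local_event C P \<Longrightarrow> \<P>(x in M. P x) = \<P>(x in N. P x)"
  shows "M = N"
proof (rule measure_eqI_PiM_infinite[of M UNIV "\<lambda>_. count_space F" N])
  interpret M: prob_space M by (rule prob_space_config_measure[OF assms(1)])
  interpret N: prob_space N by (rule prob_space_config_measure[OF assms(2)])
  show "sets M = PiM UNIV (\<lambda>_. count_space F)" "sets N = PiM UNIV (\<lambda>_. count_space F)"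
    using assms(1,2) by (auto simp: config_measure_def)
  show "finite_measure M" by unfold_locales
  fix A :: "'a \<Rightarrow> real set" and J :: "'a set" assume J: "finite J"
  have emb: "prod_emb UNIV (\<lambda>_. count_space F) J (Pi\<^sub>E J A) = {x \<in> UNIV \<rightarrow>\<^sub>E F. \<forall>i\<in>J. x i \<in> A i}"
    by (auto simp: prod_emb_def)
  have "local_event J (\<lambda>x. \<forall>i\<in>J. x i \<in> A i)" by (auto simp: local_event_def)
  from eq[OF J this]
  show "M (prod_emb UNIV (\<lambda>_. count_space F) J (Pi\<^sub>E J A)) = N (prod_emb UNIV (\<lambda>_. count_space F) J (Pi\<^sub>E J A))"
    by (simp add: emb space_config_measure[OF assms(1)] space_config_measure[OF assms(2)]
        M.emeasure_eq_measure N.emeasure_eq_measure)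
qed

lemma converges_weakly_local_event:
  assumes "converges_weakly F \<Lambda> m M" "config_measure F M" "finite C" "local_event C P"
    and "eventually (\<lambda>n. C \<subseteq> \<Lambda> n) sequentially"
  shows "(\<lambda>n. \<Sum>\<omega>\<in>{\<omega> \<in> \<Lambda> n \<rightarrow>\<^sub>E F. P \<omega>}. m n \<omega>) \<longlonglongrightarrow> \<P>(x in M. P x)"
proof -
  let ?E = "{z \<in> C \<rightarrow>\<^sub>E F. P z}"
  have lim: "(\<lambda>n. \<Sum>\<omega>\<in>{\<omega> \<in> \<Lambda> n \<rightarrow>\<^sub>E F. restrict \<omega> C \<in> ?E}. m n \<omega>)
      \<longlonglongrightarrow> measure M {x \<in> space M. restrict x C \<in> ?E}"
    using assms(1)[unfolded converges_weakly_def, rule_format, OF assms(3), of ?E] by auto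
  have eq: "{x \<in> space M. restrict x C \<in> ?E} = {x \<in> space M. P x}"
    using space_config_measure[OF assms(2)] local_event_restrict_iff[OF assms(4)] by (auto simp: PiE_iff)
  have "{\<omega> \<in> \<Lambda> n \<rightarrow>\<^sub>E F. restrict \<omega> C \<in> ?E} = {\<omega> \<in> \<Lambda> n \<rightarrow>\<^sub>E F. P \<omega>}" if "C \<subseteq> \<Lambda> n" for n
    using that local_event_restrict_iff[OF assms(4)] by (auto simp: PiE_iff)
  then have ev: "eventually (\<lambda>n. (\<Sum>\<omega>\<in>{\<omega> \<in> \<Lambda> n \<rightarrow>\<^sub>E F. restrict \<omega> C \<in> ?E}. m n \<omega>)
      = (\<Sum>\<omega>\<in>{\<omega> \<in> \<Lambda> n \<rightarrow>\<^sub>E F. P \<omega>}. m n \<omega>)) sequentially"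
    using assms(5) by (auto elim!: eventually_mono)
  show ?thesis using Lim_transform_eventually[OF lim ev] unfolding eq .
qed

section \<open>A local description of Gibbs states\<close>

text \<open>The consistency relations for the volume \<open>\<Delta>\<close>, expressed with events of
  finitely many coordinates so that they can be tested along a weakly convergent sequence. All finite
  \<open>C\<close> containing the outer neighbourhood are allowed: these events generate the outside algebra,
  those with \<open>C\<close> equal to the outer neighbourhood do not.\<close>

definition local_DLR ::
  "real set \<Rightarrow> 'v set set \<Rightarrow> ('v set \<Rightarrow> 'v config \<Rightarrow> ereal) \<Rightarrow> 'v config measure \<Rightarrow> 'v set \<Rightarrow> bool" where
  "local_DLR F B \<phi> M \<Delta> \<longleftrightarrow>
     (\<forall>C y. \<forall>\<xi>\<in>\<Delta> \<rightarrow>\<^sub>E F. finite C \<longrightarrow> C \<inter> \<Delta> = {} \<longrightarrow> outer_nbhd B \<Delta> \<subseteq> C \<longrightarrow>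
        \<P>(x in M. restrict x \<Delta> = \<xi> \<and> restrict x C = y)
        = gibbs F B \<phi> \<Delta> y \<xi> * \<P>(x in M. restrict x C = y))"

lemma outside_algebra_subalgebra:
  assumes "config_measure F M"
  shows "subalgebra M (outside_algebra F \<Delta>)"
proof -
  have "(\<lambda>x. restrict x (- \<Delta>)) \<in> measurable (PiM UNIV (\<lambda>_. count_space F)) (PiM (- \<Delta>) (\<lambda>_. count_space F))"
    by (rule measurable_restrict_subset) simp
  then have "(\<lambda>x. restrict x (- \<Delta>)) \<in> measurable M (PiM (- \<Delta>) (\<lambda>_. count_space F))"
    using assms by (simp add: config_measure_def cong: measurable_cong_sets)
  then have "sets (outside_algebra F \<Delta>) \<subseteq> sets M"
    unfolding outside_algebra_def
    using space_config_measure[OF assms] by (intro sets_image_in_sets) auto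
  then show ?thesis
    using space_config_measure[OF assms] by (auto simp: subalgebra_def outside_algebra_def)
qed

lemma borel_measurable_gibbs_outside:
  assumes "finite F" "locally_finite_hyperbonds B" "finite \<Delta>"
  shows "(\<lambda>x. gibbs F B \<phi> \<Delta> x \<xi>) \<in> borel_measurable (outside_algebra F \<Delta>)"
proof -
  let ?C = "outer_nbhd B \<Delta>"
  have "(\<lambda>x. gibbs F B \<phi> \<Delta> (restrict x ?C) \<xi>) \<in> borel_measurable (outside_algebra F \<Delta>)"
    by (rule measurable_compose[OF measurable_restrict_outside_algebra[OF assms(1) finite_outer_nbhd[OF assms(2,3)]]])
      (auto simp: outer_nbhd_def)
  moreover have "gibbs F B \<phi> \<Delta> (restrict x ?C) = gibbs F B \<phi> \<Delta> x" for x
    by (rule gibbs_cong) simp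
  ultimately show ?thesis by simp
qed

lemma gibbs_le_1:
  assumes "finite F" "finite \<Delta>" "\<xi> \<in> \<Delta> \<rightarrow>\<^sub>E F"
  shows "gibbs F B \<phi> \<Delta> x \<xi> \<le> 1"
proof -
  have "gibbs_weight B \<phi> \<Delta> x \<xi> \<le> partition_function F B \<phi> \<Delta> x"
    unfolding partition_function_def using assms
    by (intro member_le_sum) (auto simp: gibbs_weight_nonneg intro: finite_PiE)
  then show ?thesis
    using partition_function_nonneg[of F B \<phi> \<Delta> x] by (auto simp: gibbs_def divide_le_eq_1)
qed

text \<open>The conditional expectation is integrated over the event \<open>restrict x C = y\<close>, on which
  the conditional probability is constant.\<close>

lemma gibbs_state_local_DLR:
  assumes "M \<in> gibbs_states F B \<phi>" "finite F" "locally_finite_hyperbonds B" "finite \<Delta>"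
  shows "local_DLR F B \<phi> M \<Delta>"
  unfolding local_DLR_def
proof (intro allI ballI impI)
  fix C y \<xi>
  assume \<xi>: "\<xi> \<in> \<Delta> \<rightarrow>\<^sub>E F" and C: "finite C" "C \<inter> \<Delta> = {}" "outer_nbhd B \<Delta> \<subseteq> C"
  have cm: "config_measure F M"
    and ae: "AE x in M. real_cond_exp M (outside_algebra F \<Delta>) (indicator {y. restrict y \<Delta> = \<xi>}) x = gibbs F B \<phi> \<Delta> x \<xi>"
    using assms(1,4) \<xi> by (auto simp: gibbs_states_def)
  interpret prob_space M by (rule prob_space_config_measure[OF cm])
  interpret finite_measure_subalgebra M "outside_algebra F \<Delta>"
    by standard (rule outside_algebra_subalgebra[OF cm])
  let ?f = "indicator {y. restrict y \<Delta> = \<xi>} :: 'a config \<Rightarrow> real"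
  let ?A = "{x \<in> space M. restrict x C = y}"
  have A: "?A \<in> sets (outside_algebra F \<Delta>)"
  proof -
    have "?A = (\<lambda>x. restrict x C) -` ({y} \<inter> (C \<rightarrow>\<^sub>E F)) \<inter> space (outside_algebra F \<Delta>)"
      using space_config_measure[OF cm] by (auto simp: outside_algebra_def PiE_iff)
    then show ?thesis
      using measurable_sets[OF measurable_restrict_outside_algebra[OF assms(2) C(1,2)], of "{y} \<inter> (C \<rightarrow>\<^sub>E F)"]
      by simp
  qed
  then have AM: "?A \<in> sets M" using subalg by (auto simp: subalgebra_def)
  have Ex: "{x \<in> space M. restrict x \<Delta> = \<xi>} \<in> sets M"
    using cm assms(2,4) by (intro local_event_sets[of F M \<Delta>] local_event_eq) auto
  have "integrable M (indicator {x \<in> space M. restrict x \<Delta> = \<xi>} :: _ \<Rightarrow> real)"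
    using Ex by (simp add: emeasure_eq_measure)
  then have int: "integrable M ?f"
    by (subst Bochner_Integration.integrable_cong[OF refl, of M _ "indicator {x \<in> space M. restrict x \<Delta> = \<xi>}"])
      (auto simp: indicator_def)
  have "\<P>(x in M. restrict x \<Delta> = \<xi> \<and> restrict x C = y)
      = (\<integral>x. indicator {x \<in> space M. restrict x \<Delta> = \<xi> \<and> restrict x C = y} x \<partial>M)"
    by (simp add: Int_absorb2 subset_iff)
  also have "\<dots> = (\<integral>x\<in>?A. ?f x \<partial>M)"
    unfolding set_lebesgue_integral_def
    by (intro Bochner_Integration.integral_cong refl) (auto simp: indicator_def)
  also have "\<dots> = (\<integral>x\<in>?A. real_cond_exp M (outside_algebra F \<Delta>) ?f x \<partial>M)"
    by (rule real_cond_exp_intA[OF int A])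
  also have "\<dots> = (\<integral>x\<in>?A. gibbs F B \<phi> \<Delta> x \<xi> \<partial>M)"
    using ae AM borel_measurable_gibbs_outside[OF assms(2-4)] subalg
    by (intro set_lebesgue_integral_cong_AE)
      (auto intro: measurable_from_subalg borel_measurable_cond_exp2)
  also have "\<dots> = (\<integral>x. gibbs F B \<phi> \<Delta> y \<xi> * indicator ?A x \<partial>M)"
    unfolding set_lebesgue_integral_def
  proof (intro Bochner_Integration.integral_cong refl)
    fix x
    have "gibbs F B \<phi> \<Delta> x = gibbs F B \<phi> \<Delta> y" if "restrict x C = y"
      using that C(3) by (intro gibbs_cong) auto
    then show "indicator ?A x *\<^sub>R gibbs F B \<phi> \<Delta> x \<xi> = gibbs F B \<phi> \<Delta> y \<xi> * indicator ?A x"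
      by (simp add: indicator_def)
  qed
  also have "\<dots> = gibbs F B \<phi> \<Delta> y \<xi> * \<P>(x in M. restrict x C = y)"
    using AM by (simp add: Int_absorb1)
  finally show "\<P>(x in M. restrict x \<Delta> = \<xi> \<and> restrict x C = y)
        = gibbs F B \<phi> \<Delta> y \<xi> * \<P>(x in M. restrict x C = y)" .
qed

text \<open>The conditional probability is a step function of the coordinates in the outer neighbourhood, so
  its integral over a local outside event is a finite sum of instances of \<open>local_DLR\<close>.\<close>

lemma integral_gibbs_local_event:
  assumes cm: "config_measure F M" and F: "finite F" and B: "locally_finite_hyperbonds B"
    and \<Delta>: "finite \<Delta>" and dlr: "local_DLR F B \<phi> M \<Delta>" and \<xi>: "\<xi> \<in> \<Delta> \<rightarrow>\<^sub>E F"
    and C: "finite C" "C \<inter> \<Delta> = {}" and P: "local_event C P"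
  shows "(\<integral>x. gibbs F B \<phi> \<Delta> x \<xi> * of_bool (P x) \<partial>M) = \<P>(x in M. P x \<and> restrict x \<Delta> = \<xi>)"
proof -
  interpret prob_space M by (rule prob_space_config_measure[OF cm])
  let ?D = "C \<union> outer_nbhd B \<Delta>"
  let ?g = "\<lambda>x. gibbs F B \<phi> \<Delta> x \<xi> * of_bool (P x)"
  have D: "finite ?D" "?D \<inter> \<Delta> = {}" "outer_nbhd B \<Delta> \<subseteq> ?D"
    using C finite_outer_nbhd[OF B \<Delta>] by (auto simp: outer_nbhd_def)
  have fin: "finite (?D \<rightarrow>\<^sub>E F)" using D(1) F by (intro finite_PiE) auto
  have E: "{x \<in> space M. restrict x ?D = y} \<in> sets M" for y
    using cm F D by (intro local_event_sets[of F M ?D] local_event_eq) auto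
  have step: "?g x = (\<Sum>y\<in>?D \<rightarrow>\<^sub>E F. ?g y * indicator {x \<in> space M. restrict x ?D = y} x)"
    if x: "x \<in> space M" for x
  proof -
    have "(\<Sum>y\<in>?D \<rightarrow>\<^sub>E F. ?g y * indicator {x \<in> space M. restrict x ?D = y} x)
        = (\<Sum>y\<in>?D \<rightarrow>\<^sub>E F. if y = restrict x ?D then ?g y else 0)"
      using x by (intro sum.cong refl) (auto simp: indicator_def)
    also have "\<dots> = ?g (restrict x ?D)"
      using fin x space_config_measure[OF cm] by (auto simp: sum.delta)
    also have "gibbs F B \<phi> \<Delta> (restrict x ?D) = gibbs F B \<phi> \<Delta> x" by (rule gibbs_cong) simp
    also have "P (restrict x ?D) = P x" using local_event_restrict_iff[OF local_event_mono[OF _ P]] by blast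
    finally show ?thesis by (rule sym)
  qed
  have "(\<integral>x. ?g x \<partial>M) = (\<integral>x. (\<Sum>y\<in>?D \<rightarrow>\<^sub>E F. ?g y * indicator {x \<in> space M. restrict x ?D = y} x) \<partial>M)"
    using step by (intro Bochner_Integration.integral_cong refl)
  also have "\<dots> = (\<Sum>y\<in>?D \<rightarrow>\<^sub>E F. ?g y * \<P>(x in M. restrict x ?D = y))"
    using E by (subst Bochner_Integration.integral_sum) (auto simp: emeasure_eq_measure Int_absorb1)
  also have "\<dots> = (\<Sum>y\<in>?D \<rightarrow>\<^sub>E F. \<P>(x in M. (P x \<and> restrict x \<Delta> = \<xi>) \<and> restrict x ?D = y))"
  proof (intro sum.cong refl)
    fix y assume "y \<in> ?D \<rightarrow>\<^sub>E F"
    have Py: "P x = P y" if "restrict x ?D = y" for x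
      using that local_event_restrict_iff[OF local_event_mono[OF _ P], of ?D x] by auto
    have "{x \<in> space M. (P x \<and> restrict x \<Delta> = \<xi>) \<and> restrict x ?D = y}
        = (if P y then {x \<in> space M. restrict x \<Delta> = \<xi> \<and> restrict x ?D = y} else {})"
      using Py by auto
    moreover have "\<P>(x in M. restrict x \<Delta> = \<xi> \<and> restrict x ?D = y)
        = gibbs F B \<phi> \<Delta> y \<xi> * \<P>(x in M. restrict x ?D = y)"
      using dlr \<xi> D unfolding local_DLR_def by blast
    ultimately show "?g y * \<P>(x in M. restrict x ?D = y)
        = \<P>(x in M. (P x \<and> restrict x \<Delta> = \<xi>) \<and> restrict x ?D = y)"
      by simp
  qed
  also have "\<dots> = \<P>(x in M. P x \<and> restrict x \<Delta> = \<xi>)"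
    using cm F D C \<Delta> P
    by (intro prob_split_local[of F M ?D "C \<union> \<Delta>", symmetric] local_event_conj local_event_eq) auto
  finally show ?thesis .
qed

text \<open>If the partition function vanishes at \<open>y\<close>, then \<open>gibbs\<close> is identically
  zero there by the convention for division by zero. Summing the local relation over all configurations in
  \<open>\<Delta>\<close> shows that \<open>y\<close> has probability zero; only finitely many
  \<open>y\<close> are relevant.\<close>

lemma local_DLR_partition_function_pos:
  assumes cm: "config_measure F M" and F: "finite F" and B: "locally_finite_hyperbonds B"
    and \<Delta>: "finite \<Delta>" and dlr: "local_DLR F B \<phi> M \<Delta>"
  shows "AE x in M. partition_function F B \<phi> \<Delta> x > 0"
proof -
  interpret prob_space M by (rule prob_space_config_measure[OF cm])
  let ?C = "outer_nbhd B \<Delta>"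
  let ?bad = "\<lambda>x. \<not> partition_function F B \<phi> \<Delta> x > 0"
  have C: "finite ?C" "?C \<inter> \<Delta> = {}"
    using finite_outer_nbhd[OF B \<Delta>] by (auto simp: outer_nbhd_def)
  have loc: "local_event ?C ?bad"
    unfolding local_event_def using gibbs_cong(2)[of B \<Delta>] by metis
  have "\<P>(x in M. ?bad x) = (\<Sum>y\<in>?C \<rightarrow>\<^sub>E F. \<P>(x in M. ?bad x \<and> restrict x ?C = y))"
    by (rule prob_split_local[OF cm F C(1) C(1) loc])
  also have "\<dots> = 0"
  proof (intro sum.neutral ballI)
    fix y assume "y \<in> ?C \<rightarrow>\<^sub>E F"
    show "\<P>(x in M. ?bad x \<and> restrict x ?C = y) = 0"
    proof (cases "?bad y")
      case True
      have "\<P>(x in M. restrict x ?C = y)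
          = (\<Sum>\<xi>\<in>\<Delta> \<rightarrow>\<^sub>E F. \<P>(x in M. restrict x ?C = y \<and> restrict x \<Delta> = \<xi>))"
        by (rule prob_split_local[OF cm F \<Delta> C(1) local_event_eq]) simp
      also have "\<dots> = (\<Sum>\<xi>\<in>\<Delta> \<rightarrow>\<^sub>E F. gibbs F B \<phi> \<Delta> y \<xi> * \<P>(x in M. restrict x ?C = y))"
        using dlr C by (intro sum.cong refl) (auto simp: local_DLR_def conj_commute)
      also have "\<dots> = 0"
        using True partition_function_nonneg[of F B \<phi> \<Delta> y] by (simp add: gibbs_def)
      finally have "\<P>(x in M. restrict x ?C = y) = 0" .
      moreover have "{x \<in> space M. restrict x ?C = y} \<in> sets M"
        using cm F C(1) by (intro local_event_sets[of F M ?C] local_event_eq) auto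
      ultimately show ?thesis
        using finite_measure_mono[of "{x \<in> space M. ?bad x \<and> restrict x ?C = y}" "{x \<in> space M. restrict x ?C = y}"]
        by (simp add: measure_le_0_iff subset_eq)
    next
      case False
      then have "\<not> (?bad x \<and> restrict x ?C = y)" for x
        using local_event_restrict_iff[OF loc, of x] by auto
      then have "{x \<in> space M. ?bad x \<and> restrict x ?C = y} = {}" by blast
      then show ?thesis by (metis measure_empty)
    qed
  qed
  finally have "\<P>(x in M. ?bad x) = 0" .
  moreover have "{x \<in> space M. ?bad x} \<in> sets M"
    by (rule local_event_sets[OF cm F C(1) loc])
  ultimately show ?thesis
    by (intro AE_I[of _ _ "{x \<in> space M. ?bad x}"]) (auto simp: emeasure_eq_measure)
qed

text \<open>The two finite measures obtained by weighting \<open>M\<close> with the indicator and with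
  \<open>gibbs\<close> and projecting to the outside agree on cylinders, hence everywhere; this is the
  defining property of the conditional expectation.\<close>

lemma local_DLR_cond_exp:
  assumes cm: "config_measure F M" and F: "finite F" and B: "locally_finite_hyperbonds B"
    and \<Delta>: "finite \<Delta>" and dlr: "local_DLR F B \<phi> M \<Delta>" and \<xi>: "\<xi> \<in> \<Delta> \<rightarrow>\<^sub>E F"
  shows "AE x in M. real_cond_exp M (outside_algebra F \<Delta>) (indicator {y. restrict y \<Delta> = \<xi>}) x
    = gibbs F B \<phi> \<Delta> x \<xi>"
proof -
  interpret prob_space M by (rule prob_space_config_measure[OF cm])
  have sub: "subalgebra M (outside_algebra F \<Delta>)" by (rule outside_algebra_subalgebra[OF cm])
  interpret finite_measure_subalgebra M "outside_algebra F \<Delta>"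
    by standard (rule sub)
  let ?f = "indicator {y. restrict y \<Delta> = \<xi>} :: 'a config \<Rightarrow> real"
  let ?g = "\<lambda>x. gibbs F B \<phi> \<Delta> x \<xi>"
  let ?r = "\<lambda>x :: 'a config. restrict x (- \<Delta>)"
  let ?S = "PiM (- \<Delta>) (\<lambda>_. count_space F)"
  have Ex: "{x \<in> space M. restrict x \<Delta> = \<xi>} \<in> sets M"
    using cm F \<Delta> by (intro local_event_sets[of F M \<Delta>] local_event_eq) auto
  have f: "?f \<in> borel_measurable M"
    by (subst measurable_cong[of M _ "indicator {x \<in> space M. restrict x \<Delta> = \<xi>}"])
      (use Ex in \<open>auto simp: indicator_def\<close>)
  have g: "?g \<in> borel_measurable M"
    using borel_measurable_gibbs_outside[OF F B \<Delta>] sub by (rule measurable_from_subalg[rotated])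
  have intf: "integrable M ?f" using f by (intro integrable_const_bound[of _ 1]) auto
  have intg: "integrable M ?g"
    using g gibbs_le_1[OF F \<Delta> \<xi>] by (intro integrable_const_bound[of _ 1]) (auto simp: gibbs_nonneg)
  have r: "?r \<in> measurable M ?S"
  proof -
    have "?r \<in> measurable (outside_algebra F \<Delta>) ?S"
      unfolding outside_algebra_def by (rule measurable_vimage_algebra1) (auto simp: space_PiM)
    then show ?thesis using sub by (rule measurable_from_subalg[rotated])
  qed
  define N where "N h = distr (density M (\<lambda>x. ennreal (h x))) ?S ?r" for h
  have N: "emeasure (N h) A = ennreal (\<integral>x\<in>?r -` A \<inter> space M. h x \<partial>M)"
    if "A \<in> sets ?S" "integrable M h" "\<And>x. h x \<ge> 0" for h A
  proof -
    have A: "?r -` A \<inter> space M \<in> sets M" using measurable_sets[OF r that(1)] .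
    have hm: "h \<in> borel_measurable M" using that(2) by auto
    have "emeasure (N h) A = emeasure (density M (\<lambda>x. ennreal (h x))) (?r -` A \<inter> space M)"
      unfolding N_def using r that(1) by (subst emeasure_distr) auto
    also have "\<dots> = (\<integral>\<^sup>+x. ennreal (h x) * indicator (?r -` A \<inter> space M) x \<partial>M)"
      using A hm by (subst emeasure_density) auto
    also have "\<dots> = (\<integral>\<^sup>+x. ennreal (indicator (?r -` A \<inter> space M) x *\<^sub>R h x) \<partial>M)"
      by (intro nn_integral_cong) (auto simp: indicator_def)
    also have "\<dots> = ennreal (\<integral>x\<in>?r -` A \<inter> space M. h x \<partial>M)"
      unfolding set_lebesgue_integral_def using that A
      by (intro nn_integral_eq_integral integrable_mult_indicator) auto
    finally show ?thesis .
  qed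
  have eq: "N ?f = N ?g"
  proof (rule measure_eqI_PiM_infinite[of _ "- \<Delta>" "\<lambda>_. count_space F"])
    show "sets (N ?f) = ?S" "sets (N ?g) = ?S" by (simp_all add: N_def)
    have "space (N ?f) = space ?S" by (simp add: N_def)
    then have "emeasure (N ?f) (space (N ?f)) \<noteq> \<infinity>"
      using N[OF sets.top intf] by simp
    then show "finite_measure (N ?f)" by (rule finite_measureI)
    fix A :: "'a \<Rightarrow> real set" and J :: "'a set"
    assume J: "finite J" "J \<subseteq> - \<Delta>" and A: "\<And>i. i \<in> J \<Longrightarrow> A i \<in> sets (count_space F)"
    let ?X = "prod_emb (- \<Delta>) (\<lambda>_. count_space F) J (Pi\<^sub>E J A)"
    let ?P = "\<lambda>x. \<forall>i\<in>J. x i \<in> A i"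
    have X: "?X \<in> sets ?S" using J A by (intro sets_PiM_I) auto
    have pre: "?r -` ?X \<inter> space M = {x \<in> space M. ?P x}"
      using space_config_measure[OF cm] J(2) by (fastforce simp: prod_emb_def PiE_iff restrict_def extensional_def)
    have loc: "local_event J ?P" by (auto simp: local_event_def)
    have "(\<integral>x\<in>{x \<in> space M. ?P x}. ?f x \<partial>M)
        = (\<integral>x. indicator {x \<in> space M. ?P x \<and> restrict x \<Delta> = \<xi>} x \<partial>M)"
      unfolding set_lebesgue_integral_def
      by (intro Bochner_Integration.integral_cong refl) (auto simp: indicator_def)
    also have "\<dots> = \<P>(x in M. ?P x \<and> restrict x \<Delta> = \<xi>)"
      by (simp add: Int_absorb2 subset_iff)
    also have "\<dots> = (\<integral>x. ?g x * of_bool (?P x) \<partial>M)"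
      using J by (intro integral_gibbs_local_event[OF cm F B \<Delta> dlr \<xi> _ _ loc, symmetric]) auto
    also have "\<dots> = (\<integral>x\<in>{x \<in> space M. ?P x}. ?g x \<partial>M)"
      unfolding set_lebesgue_integral_def
      by (intro Bochner_Integration.integral_cong refl) (auto simp: indicator_def)
    finally show "emeasure (N ?f) ?X = emeasure (N ?g) ?X"
      using N[OF X intf] N[OF X intg] by (simp add: pre gibbs_nonneg)
  qed
  show ?thesis
  proof (rule real_cond_exp_charact[OF _ intf intg borel_measurable_gibbs_outside[OF F B \<Delta>]])
    fix A assume "A \<in> sets (outside_algebra F \<Delta>)"
    moreover have "?r \<in> (UNIV \<rightarrow>\<^sub>E F) \<rightarrow> space ?S" by (auto simp: space_PiM)
    ultimately obtain A' where A': "A' \<in> sets ?S" "A = ?r -` A' \<inter> space M"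
      unfolding outside_algebra_def space_config_measure[OF cm]
      using sets_vimage_algebra2[of ?r "UNIV \<rightarrow>\<^sub>E F" ?S] by auto
    have "ennreal (\<integral>x\<in>A. ?f x \<partial>M) = ennreal (\<integral>x\<in>A. ?g x \<partial>M)"
      using N[OF A'(1) intf] N[OF A'(1) intg] eq A'(2) by (simp add: gibbs_nonneg)
    moreover have "(\<integral>x\<in>A. ?f x \<partial>M) \<ge> 0" "(\<integral>x\<in>A. ?g x \<partial>M) \<ge> 0"
      by (auto simp: set_lebesgue_integral_def gibbs_nonneg)
    ultimately show "(\<integral>x\<in>A. ?f x \<partial>M) = (\<integral>x\<in>A. ?g x \<partial>M)" by simp
  qed
qed

lemma gibbs_states_iff_local_DLR:
  assumes "finite F" "locally_finite_hyperbonds B"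
  shows "M \<in> gibbs_states F B \<phi> \<longleftrightarrow> config_measure F M \<and> (\<forall>\<Delta>. finite \<Delta> \<longrightarrow> local_DLR F B \<phi> M \<Delta>)"
proof
  assume "M \<in> gibbs_states F B \<phi>"
  then show "config_measure F M \<and> (\<forall>\<Delta>. finite \<Delta> \<longrightarrow> local_DLR F B \<phi> M \<Delta>)"
    using gibbs_state_local_DLR[OF _ assms] by (auto simp: gibbs_states_def)
next
  assume M: "config_measure F M \<and> (\<forall>\<Delta>. finite \<Delta> \<longrightarrow> local_DLR F B \<phi> M \<Delta>)"
  then have cm: "config_measure F M" and dlr: "local_DLR F B \<phi> M \<Delta>" if "finite \<Delta>" for \<Delta>
    using that by auto
  show "M \<in> gibbs_states F B \<phi>"
    unfolding gibbs_states_def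
    using M local_DLR_partition_function_pos[OF cm assms _ dlr] local_DLR_cond_exp[OF cm assms _ dlr] by auto
qed

lemma eventually_subset_volumes:
  assumes "filterlim \<Lambda> (finite_subsets_at_top UNIV) sequentially" "finite C"
  shows "eventually (\<lambda>n. C \<subseteq> \<Lambda> n) sequentially"
proof -
  have "eventually (\<lambda>X. C \<subseteq> X) (finite_subsets_at_top UNIV)"
    unfolding eventually_finite_subsets_at_top using assms(2) by auto
  then show ?thesis by (rule eventually_compose_filterlim[OF _ assms(1)])
qed

text \<open>Both sides of the relation are continuous under weak convergence, because \<open>gibbs F B \<phi>
  \<Delta> y \<xi>\<close> is a constant once \<open>y\<close> is fixed.\<close>

lemma weak_limit_local_DLR:
  assumes F: "finite F" and B: "locally_finite_hyperbonds B" and \<phi>: "is_interaction F B \<phi>"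
    and \<Lambda>: "\<And>n. finite (\<Lambda> n)" "filterlim \<Lambda> (finite_subsets_at_top UNIV) sequentially"
    and \<tau>: "\<And>n. \<tau> n \<in> - \<Lambda> n \<rightarrow> F"
    and cm: "config_measure F M"
    and conv: "converges_weakly F \<Lambda> (\<lambda>n. gibbs F B \<phi> (\<Lambda> n) (\<tau> n)) M"
    and \<Delta>: "finite \<Delta>"
  shows "local_DLR F B \<phi> M \<Delta>"
  unfolding local_DLR_def
proof (intro allI ballI impI)
  fix C y \<xi>
  assume \<xi>: "\<xi> \<in> \<Delta> \<rightarrow>\<^sub>E F" and C: "finite C" "C \<inter> \<Delta> = {}" "outer_nbhd B \<Delta> \<subseteq> C"
  have large: "eventually (\<lambda>n. C \<subseteq> \<Lambda> n \<and> \<Delta> \<subseteq> \<Lambda> n) sequentially"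
    using eventually_subset_volumes[OF \<Lambda>(2)] C(1) \<Delta> by (simp add: eventually_conj_iff)
  let ?S = "\<lambda>n P. \<Sum>\<omega>\<in>{\<omega> \<in> \<Lambda> n \<rightarrow>\<^sub>E F. P \<omega>}. gibbs F B \<phi> (\<Lambda> n) (\<tau> n) \<omega>"
  have "(\<lambda>n. ?S n (\<lambda>\<omega>. restrict \<omega> \<Delta> = \<xi> \<and> restrict \<omega> C = y))
      \<longlonglongrightarrow> \<P>(x in M. restrict x \<Delta> = \<xi> \<and> restrict x C = y)"
    using C(1) \<Delta> large
    by (intro converges_weakly_local_event[OF conv cm, of "\<Delta> \<union> C"] local_event_conj local_event_eq)
      (auto elim: eventually_mono)
  moreover have "eventually (\<lambda>n. ?S n (\<lambda>\<omega>. restrict \<omega> \<Delta> = \<xi> \<and> restrict \<omega> C = y)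
      = gibbs F B \<phi> \<Delta> y \<xi> * ?S n (\<lambda>\<omega>. restrict \<omega> C = y)) sequentially"
    using large
  proof eventually_elim
    case (elim n)
    then show ?case
      using gibbs_consistent[OF F \<phi> B \<Lambda>(1)[of n] _ _ C(2,3) \<tau>[of n] \<xi>] by blast
  qed
  ultimately have "(\<lambda>n. gibbs F B \<phi> \<Delta> y \<xi> * ?S n (\<lambda>\<omega>. restrict \<omega> C = y))
      \<longlonglongrightarrow> \<P>(x in M. restrict x \<Delta> = \<xi> \<and> restrict x C = y)"
    by (rule Lim_transform_eventually)
  moreover have "(\<lambda>n. gibbs F B \<phi> \<Delta> y \<xi> * ?S n (\<lambda>\<omega>. restrict \<omega> C = y))
      \<longlonglongrightarrow> gibbs F B \<phi> \<Delta> y \<xi> * \<P>(x in M. restrict x C = y)"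
    using C(1) large
    by (intro tendsto_mult tendsto_const converges_weakly_local_event[OF conv cm, of C] local_event_eq)
      (auto elim: eventually_mono)
  ultimately show "\<P>(x in M. restrict x \<Delta> = \<xi> \<and> restrict x C = y)
        = gibbs F B \<phi> \<Delta> y \<xi> * \<P>(x in M. restrict x C = y)"
    by (rule LIMSEQ_unique)
qed

section \<open>Clusters of active hyperbonds\<close>

lemma connected_by_snoc:
  assumes "connected_by \<alpha> M1 {v}" "v \<in> b" "b \<in> \<alpha>" "b \<inter> M2 \<noteq> {}"
  shows "connected_by \<alpha> M1 M2"
proof -
  obtain bs where bs: "bs \<noteq> []" "set bs \<subseteq> \<alpha>" "hd bs \<inter> M1 \<noteq> {}" "v \<in> last bs"
    and step: "\<And>l. Suc l < length bs \<Longrightarrow> bs ! l \<inter> bs ! Suc l \<noteq> {}"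
    using assms(1) by (auto simp: connected_by_def)
  have "(bs @ [b]) ! l \<inter> (bs @ [b]) ! Suc l \<noteq> {}" if "Suc l < length (bs @ [b])" for l
  proof (cases "Suc l < length bs")
    case True
    then show ?thesis using step by (simp add: nth_append)
  next
    case False
    then have "Suc l = length bs" using that by simp
    moreover from this have "bs ! l = last bs" using bs(1) by (metis diff_Suc_1 last_conv_nth)
    ultimately show ?thesis using bs(4) assms(2) by (auto simp: nth_append)
  qed
  then show ?thesis
    unfolding connected_by_def using bs assms by (intro exI[of _ "bs @ [b]"]) auto
qed

definition cluster :: "'v set set \<Rightarrow> 'v set \<Rightarrow> 'v set" where
  "cluster \<alpha> \<Lambda>0 = \<Lambda>0 \<union> {v. connected_by \<alpha> \<Lambda>0 {v}}"

lemma cluster_closed: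
  assumes "b \<in> \<alpha>" "b \<inter> cluster \<alpha> \<Lambda>0 \<noteq> {}"
  shows "b \<subseteq> cluster \<alpha> \<Lambda>0"
proof
  fix w assume w: "w \<in> b"
  obtain v where v: "v \<in> b" "v \<in> \<Lambda>0 \<or> connected_by \<alpha> \<Lambda>0 {v}"
    using assms(2) by (auto simp: cluster_def)
  have "connected_by \<alpha> \<Lambda>0 {w}"
  proof (cases "v \<in> \<Lambda>0")
    case True
    then show ?thesis
      unfolding connected_by_def using v(1) w assms(1) by (intro exI[of _ "[b]"]) auto
  next
    case False
    then show ?thesis using v w assms(1) connected_by_snoc[of \<alpha> \<Lambda>0 v b "{w}"] by auto
  qed
  then show "w \<in> cluster \<alpha> \<Lambda>0" by (simp add: cluster_def)
qed

text \<open>Along a chain starting in \<open>\<Lambda>0\<close>, the first hyperbond not contained in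
  \<open>\<Lambda>1\<close> still meets \<open>\<Lambda>1\<close>, and the part of the chain up to it connects
  \<open>\<Lambda>0\<close> to the boundary of \<open>\<Lambda>1\<close>.\<close>

lemma cluster_subset:
  assumes "\<alpha> \<subseteq> B" "\<Lambda>0 \<subseteq> \<Lambda>1" "\<not> connected_by \<alpha> \<Lambda>0 (hboundary B \<Lambda>1)"
  shows "cluster \<alpha> \<Lambda>0 \<subseteq> \<Lambda>1"
proof
  fix v assume "v \<in> cluster \<alpha> \<Lambda>0"
  then consider "v \<in> \<Lambda>0" | "connected_by \<alpha> \<Lambda>0 {v}" by (auto simp: cluster_def)
  then show "v \<in> \<Lambda>1"
  proof cases
    case 2
    then obtain bs where bs: "bs \<noteq> []" "set bs \<subseteq> \<alpha>" "hd bs \<inter> \<Lambda>0 \<noteq> {}" "v \<in> last bs"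
      and step: "\<And>l. Suc l < length bs \<Longrightarrow> bs ! l \<inter> bs ! Suc l \<noteq> {}"
      by (auto simp: connected_by_def)
    have "bs ! k \<subseteq> \<Lambda>1" if "k < length bs" for k
      using that
    proof (induction k)
      case k: 0
      have meets: "bs ! 0 \<inter> \<Lambda>1 \<noteq> {}" using bs(1,3) assms(2) by (auto simp: hd_conv_nth)
      show ?case
      proof (rule ccontr)
        assume "\<not> ?case"
        moreover have mem: "bs ! 0 \<in> \<alpha>" using bs(2) k by (meson nth_mem subsetD)
        then have "bs ! 0 \<in> B" using assms(1) by auto
        ultimately have "bs ! 0 \<inter> hboundary B \<Lambda>1 \<noteq> {}"
          using meets unfolding hboundary_def by blast
        then have "connected_by \<alpha> \<Lambda>0 (hboundary B \<Lambda>1)"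
          unfolding connected_by_def using bs mem by (intro exI[of _ "[bs ! 0]"]) (auto simp: hd_conv_nth)
        then show False using assms(3) by simp
      qed
    next
      case k: (Suc k)
      have meets: "bs ! Suc k \<inter> \<Lambda>1 \<noteq> {}" using k step[of k] by auto
      show ?case
      proof (rule ccontr)
        assume "\<not> ?case"
        moreover have "bs ! Suc k \<in> B" using bs(2) assms(1) k by (meson nth_mem subsetD)
        ultimately have "bs ! Suc k \<inter> hboundary B \<Lambda>1 \<noteq> {}"
          using meets unfolding hboundary_def by blast
        moreover have "last (take (Suc (Suc k)) bs) = bs ! Suc k"
          using k.prems by (simp add: take_Suc_conv_app_nth)
        moreover have "set (take (Suc (Suc k)) bs) \<subseteq> \<alpha>" using bs(2) set_take_subset by fastforce
        ultimately have "connected_by \<alpha> \<Lambda>0 (hboundary B \<Lambda>1)"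
          unfolding connected_by_def using bs step
          by (intro exI[of _ "take (Suc (Suc k)) bs"]) auto
        then show False using assms(3) by simp
      qed
    qed
    moreover have "last bs = bs ! (length bs - 1)" "length bs - 1 < length bs"
      using bs(1) by (auto simp: last_conv_nth)
    ultimately show ?thesis using bs(4) by fastforce
  qed (use assms(2) in auto)
qed

section \<open>Exchanging the copies on a cluster\<close>

lemma finite_compatible_configs:
  "finite F \<Longrightarrow> finite C \<Longrightarrow> finite (compatible_configs F \<sigma> C)"
  unfolding compatible_configs_def by (intro finite_PiE) (auto simp: compatible_spins_def)

lemma compatible_spins_compl: "a \<in> compatible_spins F s \<Longrightarrow> s - a \<in> compatible_spins F s"
  by (force simp: compatible_spins_def)

lemma compl_config_compatible:
  "\<xi> \<in> compatible_configs F \<sigma> C \<Longrightarrow> compl_config C \<sigma> \<xi> \<in> compatible_configs F \<sigma> C"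
  by (auto simp: compatible_configs_def compl_config_def PiE_iff compatible_spins_compl)

lemma restrict_compatible:
  "\<omega> \<in> compatible_configs F \<sigma> \<Lambda> \<Longrightarrow> C \<subseteq> \<Lambda> \<Longrightarrow> restrict \<omega> C \<in> compatible_configs F \<sigma> C"
  by (auto simp: compatible_configs_def PiE_iff)

text \<open>The unnormalized joint law of the spins and the random subsets (an Edwards-Sokal coupling); its
  marginals are \<open>rc_weight\<close> and, up to normalization, \<open>rc_prob\<close>.\<close>

definition rc_joint ::
  "'v set set \<Rightarrow> 'v set \<Rightarrow> ('v set \<Rightarrow> 'v config set \<Rightarrow> real) \<Rightarrow> 'v config \<Rightarrow> ('v set \<Rightarrow> 'v config set) \<Rightarrow> real" where
  "rc_joint B \<Lambda> nu \<omega> \<eta> =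
     rc_product B \<Lambda> nu \<eta> * (\<Prod>b\<in>touching B \<Lambda>. of_bool (restrict \<omega> (b \<inter> \<Lambda>) \<in> \<eta> b))"

text \<open>The probability that the hyperbond is active and allows \<open>\<xi>\<close>.\<close>

definition active_factor ::
  "real set \<Rightarrow> 'v set \<Rightarrow> 'v config \<Rightarrow> ('v set \<Rightarrow> 'v config set \<Rightarrow> real) \<Rightarrow> 'v set \<Rightarrow> 'v config \<Rightarrow> real" where
  "active_factor F \<Lambda> \<sigma> nu b \<xi> =
     (\<Sum>S\<in>Pow (compatible_configs F \<sigma> (b \<inter> \<Lambda>)) - {compatible_configs F \<sigma> (b \<inter> \<Lambda>)}. nu b S * of_bool (\<xi> \<in> S))"

lemma finite_rc_configs:
  assumes "finite F" "locally_finite_hyperbonds B" "finite \<Lambda>"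
  shows "finite (rc_configs F B \<Lambda> \<sigma>)"
  unfolding rc_configs_def using assms
  by (intro finite_PiE finite_touching) (auto simp: finite_compatible_configs)

text \<open>With the active set prescribed, the constraint on \<open>\<eta>\<close> is a product constraint,
  so the sum factorizes over the hyperbonds. An inactive hyperbond has a factor independent of
  \<open>\<omega>\<close>.\<close>

lemma sum_rc_joint_active_set:
  assumes "finite F" "locally_finite_hyperbonds B" "finite \<Lambda>" "\<alpha> \<subseteq> touching B \<Lambda>"
    and \<omega>: "\<omega> \<in> compatible_configs F \<sigma> \<Lambda>"
  shows "(\<Sum>\<eta>\<in>{\<eta> \<in> rc_configs F B \<Lambda> \<sigma>. active_set F B \<Lambda> \<sigma> \<eta> = \<alpha>}. rc_joint B \<Lambda> nu \<omega> \<eta>)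
    = (\<Prod>b\<in>touching B \<Lambda>. if b \<in> \<alpha> then active_factor F \<Lambda> \<sigma> nu b (restrict \<omega> (b \<inter> \<Lambda>))
        else nu b (compatible_configs F \<sigma> (b \<inter> \<Lambda>)))"
proof -
  let ?c = "\<lambda>b. compatible_configs F \<sigma> (b \<inter> \<Lambda>)"
  let ?R = "\<lambda>b. if b \<in> \<alpha> then Pow (?c b) - {?c b} else {?c b}"
  have "{\<eta> \<in> rc_configs F B \<Lambda> \<sigma>. active_set F B \<Lambda> \<sigma> \<eta> = \<alpha>} = PiE (touching B \<Lambda>) ?R"
  proof (intro set_eqI iffI)
    fix \<eta> assume "\<eta> \<in> PiE (touching B \<Lambda>) ?R"
    then have \<eta>: "\<eta> \<in> extensional (touching B \<Lambda>)" "\<And>b. b \<in> touching B \<Lambda> \<Longrightarrow> \<eta> b \<in> ?R b"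
      by (auto simp: PiE_iff)
    have "\<eta> b \<in> Pow (?c b)" if "b \<in> touching B \<Lambda>" for b
      using \<eta>(2)[OF that] by (auto split: if_splits)
    moreover have "\<eta> b \<noteq> ?c b \<longleftrightarrow> b \<in> \<alpha>" if "b \<in> touching B \<Lambda>" for b
      using \<eta>(2)[OF that] by (auto split: if_splits)
    ultimately show "\<eta> \<in> {\<eta> \<in> rc_configs F B \<Lambda> \<sigma>. active_set F B \<Lambda> \<sigma> \<eta> = \<alpha>}"
      using \<eta>(1) assms(4) by (auto simp: rc_configs_def active_set_def PiE_iff)
  qed (auto simp: rc_configs_def active_set_def PiE_iff split: if_splits)
  then have "(\<Sum>\<eta>\<in>{\<eta> \<in> rc_configs F B \<Lambda> \<sigma>. active_set F B \<Lambda> \<sigma> \<eta> = \<alpha>}. rc_joint B \<Lambda> nu \<omega> \<eta>)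
      = (\<Sum>\<eta>\<in>PiE (touching B \<Lambda>) ?R. \<Prod>b\<in>touching B \<Lambda>. nu b (\<eta> b) * of_bool (restrict \<omega> (b \<inter> \<Lambda>) \<in> \<eta> b))"
    by (simp only: rc_joint_def rc_product_def prod.distrib)
  also have "\<dots> = (\<Prod>b\<in>touching B \<Lambda>. \<Sum>S\<in>?R b. nu b S * of_bool (restrict \<omega> (b \<inter> \<Lambda>) \<in> S))"
    using assms by (intro prod_sum_PiE[symmetric] finite_touching) (auto simp: finite_compatible_configs)
  also have "\<dots> = (\<Prod>b\<in>touching B \<Lambda>. if b \<in> \<alpha> then active_factor F \<Lambda> \<sigma> nu b (restrict \<omega> (b \<inter> \<Lambda>))
        else nu b (?c b))"
    using restrict_compatible[OF \<omega>] by (intro prod.cong refl) (auto simp: active_factor_def)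
  finally show ?thesis .
qed

text \<open>The full subset allows every configuration. Removing its probability from the exchange symmetric
  probability of allowing \<open>\<xi>\<close> leaves a symmetric quantity.\<close>

lemma active_factor_compl:
  assumes "finite F" "finite \<Lambda>" "exchange_symmetric F B \<Lambda> \<sigma> nu" "b \<in> touching B \<Lambda>"
    and "\<xi> \<in> compatible_configs F \<sigma> (b \<inter> \<Lambda>)"
  shows "active_factor F \<Lambda> \<sigma> nu b (compl_config (b \<inter> \<Lambda>) \<sigma> \<xi>) = active_factor F \<Lambda> \<sigma> nu b \<xi>"
proof -
  let ?c = "compatible_configs F \<sigma> (b \<inter> \<Lambda>)"
  have fin: "finite (Pow ?c)" using assms(1,2) by (simp add: finite_compatible_configs)
  have "active_factor F \<Lambda> \<sigma> nu b \<zeta> = (\<Sum>S\<in>{S \<in> Pow ?c. \<zeta> \<in> S}. nu b S) - nu b ?c"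
    if "\<zeta> \<in> ?c" for \<zeta>
  proof -
    have "(\<Sum>S\<in>{S \<in> Pow ?c. \<zeta> \<in> S}. nu b S) = (\<Sum>S\<in>Pow ?c. nu b S * of_bool (\<zeta> \<in> S))"
      by (subst sum.inter_filter[OF fin]) (auto intro!: sum.cong)
    also have "\<dots> = nu b ?c + active_factor F \<Lambda> \<sigma> nu b \<zeta>"
      unfolding active_factor_def using that by (subst sum.remove[OF fin, of ?c]) auto
    finally show ?thesis by simp
  qed
  then show ?thesis
    using assms(3-5) compl_config_compatible[OF assms(5)] by (simp add: exchange_symmetric_def)
qed

definition swap_on :: "'v set \<Rightarrow> 'v set \<Rightarrow> 'v config \<Rightarrow> 'v config \<Rightarrow> 'v config" where
  "swap_on D \<Lambda> \<sigma> \<omega> = (\<lambda>i\<in>\<Lambda>. if i \<in> D then \<sigma> i - \<omega> i else \<omega> i)"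

lemma swap_on_compatible:
  "\<omega> \<in> compatible_configs F \<sigma> \<Lambda> \<Longrightarrow> swap_on D \<Lambda> \<sigma> \<omega> \<in> compatible_configs F \<sigma> \<Lambda>"
  by (auto simp: compatible_configs_def swap_on_def PiE_iff compatible_spins_compl)

lemma swap_on_involution:
  "\<omega> \<in> compatible_configs F \<sigma> \<Lambda> \<Longrightarrow> swap_on D \<Lambda> \<sigma> (swap_on D \<Lambda> \<sigma> \<omega>) = \<omega>"
  by (auto simp: compatible_configs_def swap_on_def PiE_iff extensional_def fun_eq_iff)

lemma sum_swap_on:
  "(\<Sum>\<omega>\<in>compatible_configs F \<sigma> \<Lambda>. f \<omega>) = (\<Sum>\<omega>\<in>compatible_configs F \<sigma> \<Lambda>. f (swap_on D \<Lambda> \<sigma> \<omega>))"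
  by (rule sum.reindex_bij_witness[of _ "swap_on D \<Lambda> \<sigma>" "swap_on D \<Lambda> \<sigma>"])
    (auto simp: swap_on_compatible swap_on_involution)

text \<open>A single \<open>\<eta>\<close> need not be symmetric under the exchange. The symmetry appears only
  after summation over all \<open>\<eta>\<close> with the given active set.\<close>

lemma sum_rc_joint_swap_on:
  assumes "finite F" "locally_finite_hyperbonds B" "finite \<Lambda>" "\<alpha> \<subseteq> touching B \<Lambda>"
    and "exchange_symmetric F B \<Lambda> \<sigma> nu"
    and \<omega>: "\<omega> \<in> compatible_configs F \<sigma> \<Lambda>"
    and D: "\<And>b. b \<in> \<alpha> \<Longrightarrow> b \<subseteq> D \<or> b \<inter> D = {}"
  shows "(\<Sum>\<eta>\<in>{\<eta> \<in> rc_configs F B \<Lambda> \<sigma>. active_set F B \<Lambda> \<sigma> \<eta> = \<alpha>}. rc_joint B \<Lambda> nu (swap_on D \<Lambda> \<sigma> \<omega>) \<eta>)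
    = (\<Sum>\<eta>\<in>{\<eta> \<in> rc_configs F B \<Lambda> \<sigma>. active_set F B \<Lambda> \<sigma> \<eta> = \<alpha>}. rc_joint B \<Lambda> nu \<omega> \<eta>)"
proof -
  have "active_factor F \<Lambda> \<sigma> nu b (restrict (swap_on D \<Lambda> \<sigma> \<omega>) (b \<inter> \<Lambda>))
      = active_factor F \<Lambda> \<sigma> nu b (restrict \<omega> (b \<inter> \<Lambda>))" if b: "b \<in> \<alpha>" for b
  proof (cases "b \<subseteq> D")
    case True
    then have "restrict (swap_on D \<Lambda> \<sigma> \<omega>) (b \<inter> \<Lambda>) = compl_config (b \<inter> \<Lambda>) \<sigma> (restrict \<omega> (b \<inter> \<Lambda>))"
      by (auto simp: swap_on_def compl_config_def fun_eq_iff)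
    then show ?thesis
      using active_factor_compl[OF assms(1,3,5) _ restrict_compatible[OF \<omega>]] b assms(4) by auto
  next
    case False
    then have "restrict (swap_on D \<Lambda> \<sigma> \<omega>) (b \<inter> \<Lambda>) = restrict \<omega> (b \<inter> \<Lambda>)"
      using D[OF b] by (auto simp: swap_on_def fun_eq_iff)
    then show ?thesis by simp
  qed
  then show ?thesis
    unfolding sum_rc_joint_active_set[OF assms(1-4) swap_on_compatible[OF \<omega>]]
      sum_rc_joint_active_set[OF assms(1-4) \<omega>]
    by (intro prod.cong refl) auto
qed

lemma sum_rc_configs_by_active_set:
  assumes "finite F" "locally_finite_hyperbonds B" "finite \<Lambda>"
  shows "(\<Sum>\<eta>\<in>{\<eta> \<in> rc_configs F B \<Lambda> \<sigma>. N (active_set F B \<Lambda> \<sigma> \<eta>)}. h \<eta>)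
    = (\<Sum>\<alpha>\<in>{\<alpha> \<in> Pow (touching B \<Lambda>). N \<alpha>}.
        \<Sum>\<eta>\<in>{\<eta> \<in> rc_configs F B \<Lambda> \<sigma>. active_set F B \<Lambda> \<sigma> \<eta> = \<alpha>}. h \<eta>)"
proof -
  let ?S = "{\<eta> \<in> rc_configs F B \<Lambda> \<sigma>. N (active_set F B \<Lambda> \<sigma> \<eta>)}"
  have "(\<Sum>\<eta>\<in>?S. h \<eta>) = (\<Sum>\<alpha>\<in>{\<alpha> \<in> Pow (touching B \<Lambda>). N \<alpha>}. \<Sum>\<eta>\<in>{\<eta> \<in> ?S. active_set F B \<Lambda> \<sigma> \<eta> = \<alpha>}. h \<eta>)"
    using finite_rc_configs[OF assms] finite_touching[OF assms(2,3)]
    by (intro sum.group[symmetric]) (auto simp: active_set_def)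
  also have "\<dots> = (\<Sum>\<alpha>\<in>{\<alpha> \<in> Pow (touching B \<Lambda>). N \<alpha>}.
        \<Sum>\<eta>\<in>{\<eta> \<in> rc_configs F B \<Lambda> \<sigma>. active_set F B \<Lambda> \<sigma> \<eta> = \<alpha>}. h \<eta>)"
    by (intro sum.cong refl) auto
  finally show ?thesis .
qed

text \<open>For each active set without connection, the exchange on the cluster \<open>D\<close> of
  \<open>\<Lambda>0\<close> is a weight-preserving involution. It acts as the full exchange on
  \<open>\<Lambda>0\<close>, since \<open>\<Lambda>0 \<subseteq> D\<close>, and trivially on \<open>C\<close>,
  since \<open>D \<subseteq> \<Lambda>1\<close>.\<close>

lemma exchange_off_connection:
  assumes fin: "finite F" "locally_finite_hyperbonds B" "finite \<Lambda>"
    and sym: "exchange_symmetric F B \<Lambda> \<sigma> nu"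
    and sub: "\<Lambda>0 \<subseteq> \<Lambda>1" "\<Lambda>0 \<subseteq> \<Lambda>" "C \<inter> \<Lambda>1 = {}" "C \<subseteq> \<Lambda>"
    and loc: "local_event \<Lambda>0 P" "local_event C Q"
  shows "(\<Sum>\<omega>\<in>compatible_configs F \<sigma> \<Lambda>.
      \<Sum>\<eta>\<in>{\<eta> \<in> rc_configs F B \<Lambda> \<sigma>. \<not> connected_by (active_set F B \<Lambda> \<sigma> \<eta>) \<Lambda>0 (hboundary B \<Lambda>1)}.
        rc_joint B \<Lambda> nu \<omega> \<eta> * of_bool (P (compl_config \<Lambda> \<sigma> \<omega>) \<and> Q \<omega>))
    = (\<Sum>\<omega>\<in>compatible_configs F \<sigma> \<Lambda>.
      \<Sum>\<eta>\<in>{\<eta> \<in> rc_configs F B \<Lambda> \<sigma>. \<not> connected_by (active_set F B \<Lambda> \<sigma> \<eta>) \<Lambda>0 (hboundary B \<Lambda>1)}.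
        rc_joint B \<Lambda> nu \<omega> \<eta> * of_bool (P \<omega> \<and> Q \<omega>))"
    (is "?lhs = ?rhs")
proof -
  let ?A = "{\<alpha> \<in> Pow (touching B \<Lambda>). \<not> connected_by \<alpha> \<Lambda>0 (hboundary B \<Lambda>1)}"
  define W where "W \<alpha> \<omega> = (\<Sum>\<eta>\<in>{\<eta> \<in> rc_configs F B \<Lambda> \<sigma>. active_set F B \<Lambda> \<sigma> \<eta> = \<alpha>}. rc_joint B \<Lambda> nu \<omega> \<eta>)" for \<alpha> \<omega>
  have expand: "(\<Sum>\<omega>\<in>compatible_configs F \<sigma> \<Lambda>.
      \<Sum>\<eta>\<in>{\<eta> \<in> rc_configs F B \<Lambda> \<sigma>. \<not> connected_by (active_set F B \<Lambda> \<sigma> \<eta>) \<Lambda>0 (hboundary B \<Lambda>1)}.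
        rc_joint B \<Lambda> nu \<omega> \<eta> * R \<omega>) = (\<Sum>\<alpha>\<in>?A. \<Sum>\<omega>\<in>compatible_configs F \<sigma> \<Lambda>. W \<alpha> \<omega> * R \<omega>)" for R
    unfolding W_def sum_distrib_right sum.swap[of _ _ ?A]
    by (intro sum.cong refl sum_rc_configs_by_active_set[OF fin])
  have "?lhs = (\<Sum>\<alpha>\<in>?A. \<Sum>\<omega>\<in>compatible_configs F \<sigma> \<Lambda>. W \<alpha> \<omega> * of_bool (P (compl_config \<Lambda> \<sigma> \<omega>) \<and> Q \<omega>))"
    by (rule expand)
  also have "\<dots> = (\<Sum>\<alpha>\<in>?A. \<Sum>\<omega>\<in>compatible_configs F \<sigma> \<Lambda>. W \<alpha> \<omega> * of_bool (P \<omega> \<and> Q \<omega>))"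
  proof (rule sum.cong[OF refl])
    fix \<alpha> assume \<alpha>: "\<alpha> \<in> ?A"
    let ?D = "cluster \<alpha> \<Lambda>0"
    have D: "\<Lambda>0 \<subseteq> ?D" "?D \<subseteq> \<Lambda>1"
      using cluster_subset[of \<alpha> B \<Lambda>0 \<Lambda>1] sub(1) \<alpha> by (auto simp: cluster_def touching_def)
    have "W \<alpha> \<omega> * of_bool (P (compl_config \<Lambda> \<sigma> \<omega>) \<and> Q \<omega>)
        = W \<alpha> (swap_on ?D \<Lambda> \<sigma> \<omega>) * of_bool (P (swap_on ?D \<Lambda> \<sigma> \<omega>) \<and> Q (swap_on ?D \<Lambda> \<sigma> \<omega>))"
      if \<omega>: "\<omega> \<in> compatible_configs F \<sigma> \<Lambda>" for \<omega>
    proof -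
      have "P (swap_on ?D \<Lambda> \<sigma> \<omega>) = P (compl_config \<Lambda> \<sigma> \<omega>)"
        by (rule local_eventD[OF loc(1)]) (use D sub(2) in \<open>auto simp: swap_on_def compl_config_def\<close>)
      moreover have "Q (swap_on ?D \<Lambda> \<sigma> \<omega>) = Q \<omega>"
        by (rule local_eventD[OF loc(2)]) (use D sub(3,4) in \<open>auto simp: swap_on_def\<close>)
      moreover have "W \<alpha> (swap_on ?D \<Lambda> \<sigma> \<omega>) = W \<alpha> \<omega>"
        unfolding W_def using \<alpha> cluster_closed
        by (intro sum_rc_joint_swap_on fin sym \<omega>) auto
      ultimately show ?thesis by simp
    qed
    then show "(\<Sum>\<omega>\<in>compatible_configs F \<sigma> \<Lambda>. W \<alpha> \<omega> * of_bool (P (compl_config \<Lambda> \<sigma> \<omega>) \<and> Q \<omega>))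
        = (\<Sum>\<omega>\<in>compatible_configs F \<sigma> \<Lambda>. W \<alpha> \<omega> * of_bool (P \<omega> \<and> Q \<omega>))"
      unfolding sum_swap_on[of "\<lambda>\<omega>. W \<alpha> \<omega> * of_bool (P \<omega> \<and> Q \<omega>)" F \<sigma> \<Lambda> ?D]
      by (intro sum.cong refl)
  qed
  also have "\<dots> = ?rhs" by (rule expand[symmetric])
  finally show ?thesis .
qed

section \<open>Correlations and connection probabilities\<close>

lemma rc_prob_eq_sum:
  assumes "finite F" "locally_finite_hyperbonds B" "finite \<Lambda>"
  shows "rc_prob F B \<Lambda> \<sigma> nu \<eta>
    = (\<Sum>\<omega>\<in>compatible_configs F \<sigma> \<Lambda>. rc_joint B \<Lambda> nu \<omega> \<eta>) / rc_norm F B \<Lambda> \<sigma> nu"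
proof -
  have "(\<Prod>b\<in>touching B \<Lambda>. of_bool (restrict \<omega> (b \<inter> \<Lambda>) \<in> \<eta> b))
      = (of_bool (\<forall>b\<in>touching B \<Lambda>. restrict \<omega> (b \<inter> \<Lambda>) \<in> \<eta> b) :: real)" for \<omega>
    using finite_touching[OF assms(2,3)] by (auto intro!: prod.neutral)
  then show ?thesis
    using finite_compatible_configs[OF assms(1,3)]
    by (simp add: rc_prob_def rc_joint_def Int_def flip: sum_distrib_left)
qed

text \<open>Without connection the two events have the same weight, so their difference is carried by the
  connected configurations, where the integrand lies between -1 and 1.\<close>

lemma nonoverlap_exchange_bound:
  assumes fin: "finite F" "locally_finite_hyperbonds B" "finite \<Lambda>"
    and rcr: "bernoulli_RCR F B \<Lambda> m \<sigma> nu" and sym: "exchange_symmetric F B \<Lambda> \<sigma> nu"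
    and sub: "\<Lambda>0 \<subseteq> \<Lambda>1" "\<Lambda>0 \<subseteq> \<Lambda>" "C \<inter> \<Lambda>1 = {}" "C \<subseteq> \<Lambda>"
    and loc: "local_event \<Lambda>0 P" "local_event C Q"
  shows "\<bar>\<Sum>\<omega>\<in>compatible_configs F \<sigma> \<Lambda>. nonoverlap_dist F \<Lambda> m \<sigma> \<omega> *
      (of_bool (P \<omega> \<and> Q \<omega>) - of_bool (P (compl_config \<Lambda> \<sigma> \<omega>) \<and> Q \<omega>))\<bar>
    \<le> rc_connection_prob F B \<Lambda> \<sigma> nu \<Lambda>0 (hboundary B \<Lambda>1)"
proof -
  let ?\<Omega> = "compatible_configs F \<sigma> \<Lambda>"
  let ?conn = "\<lambda>\<eta>. connected_by (active_set F B \<Lambda> \<sigma> \<eta>) \<Lambda>0 (hboundary B \<Lambda>1)"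
  let ?Y = "{\<eta> \<in> rc_configs F B \<Lambda> \<sigma>. ?conn \<eta>}" and ?N = "{\<eta> \<in> rc_configs F B \<Lambda> \<sigma>. \<not> ?conn \<eta>}"
  let ?J = "rc_joint B \<Lambda> nu" and ?Z = "rc_norm F B \<Lambda> \<sigma> nu"
  define d where "d \<omega> = (of_bool (P \<omega> \<and> Q \<omega>) - of_bool (P (compl_config \<Lambda> \<sigma> \<omega>) \<and> Q \<omega>) :: real)" for \<omega>
  have d1: "\<bar>d \<omega>\<bar> \<le> 1" for \<omega> by (simp add: d_def)
  have finY: "finite ?Y" "finite ?N" using finite_rc_configs[OF fin] by auto
  have J0: "?J \<omega> \<eta> \<ge> 0" if "\<eta> \<in> rc_configs F B \<Lambda> \<sigma>" for \<omega> \<eta>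
    using rcr that
    by (auto simp: bernoulli_RCR_def rc_configs_def PiE_iff rc_joint_def rc_product_def
        intro!: mult_nonneg_nonneg prod_nonneg)
  have W: "rc_weight F B \<Lambda> \<sigma> nu \<omega> = (\<Sum>\<eta>\<in>?Y. ?J \<omega> \<eta>) + (\<Sum>\<eta>\<in>?N. ?J \<omega> \<eta>)" for \<omega>
  proof -
    have "rc_configs F B \<Lambda> \<sigma> = ?Y \<union> ?N" by auto
    then have "rc_weight F B \<Lambda> \<sigma> nu \<omega> = (\<Sum>\<eta>\<in>?Y \<union> ?N. ?J \<omega> \<eta>)"
      by (simp add: rc_weight_def rc_joint_def)
    also have "\<dots> = (\<Sum>\<eta>\<in>?Y. ?J \<omega> \<eta>) + (\<Sum>\<eta>\<in>?N. ?J \<omega> \<eta>)"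
      using finY by (intro sum.union_disjoint) auto
    finally show ?thesis .
  qed
  have Z0: "?Z \<ge> 0"
    unfolding rc_norm_def W by (intro sum_nonneg add_nonneg_nonneg J0) auto
  have "(\<Sum>\<omega>\<in>?\<Omega>. nonoverlap_dist F \<Lambda> m \<sigma> \<omega> * d \<omega>) = (\<Sum>\<omega>\<in>?\<Omega>. rc_weight F B \<Lambda> \<sigma> nu \<omega> * d \<omega>) / ?Z"
    using rcr by (simp add: bernoulli_RCR_def sum_divide_distrib)
  also have "(\<Sum>\<omega>\<in>?\<Omega>. rc_weight F B \<Lambda> \<sigma> nu \<omega> * d \<omega>)
      = (\<Sum>\<omega>\<in>?\<Omega>. \<Sum>\<eta>\<in>?Y. ?J \<omega> \<eta> * d \<omega>) + (\<Sum>\<omega>\<in>?\<Omega>. \<Sum>\<eta>\<in>?N. ?J \<omega> \<eta> * d \<omega>)"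
    by (simp add: W distrib_right sum.distrib sum_distrib_right)
  also have "(\<Sum>\<omega>\<in>?\<Omega>. \<Sum>\<eta>\<in>?N. ?J \<omega> \<eta> * d \<omega>) = 0"
    using exchange_off_connection[OF fin sym sub loc]
    by (simp add: d_def right_diff_distrib sum_subtractf)
  finally have eq: "(\<Sum>\<omega>\<in>?\<Omega>. nonoverlap_dist F \<Lambda> m \<sigma> \<omega> * d \<omega>) = (\<Sum>\<omega>\<in>?\<Omega>. \<Sum>\<eta>\<in>?Y. ?J \<omega> \<eta> * d \<omega>) / ?Z"
    by simp
  have "\<bar>\<Sum>\<omega>\<in>?\<Omega>. \<Sum>\<eta>\<in>?Y. ?J \<omega> \<eta> * d \<omega>\<bar> \<le> (\<Sum>\<omega>\<in>?\<Omega>. \<Sum>\<eta>\<in>?Y. \<bar>?J \<omega> \<eta> * d \<omega>\<bar>)"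
    by (rule order_trans[OF sum_abs]) (intro sum_mono sum_abs)
  also have "\<dots> \<le> (\<Sum>\<omega>\<in>?\<Omega>. \<Sum>\<eta>\<in>?Y. ?J \<omega> \<eta>)"
    using J0 d1 by (intro sum_mono) (auto simp: abs_mult intro: mult_left_le)
  also have "(\<Sum>\<omega>\<in>?\<Omega>. \<Sum>\<eta>\<in>?Y. ?J \<omega> \<eta>) = (\<Sum>\<eta>\<in>?Y. \<Sum>\<omega>\<in>?\<Omega>. ?J \<omega> \<eta>)"
    by (rule sum.swap)
  finally have "\<bar>\<Sum>\<omega>\<in>?\<Omega>. \<Sum>\<eta>\<in>?Y. ?J \<omega> \<eta> * d \<omega>\<bar> / ?Z \<le> (\<Sum>\<eta>\<in>?Y. \<Sum>\<omega>\<in>?\<Omega>. ?J \<omega> \<eta>) / ?Z"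
    using Z0 by (rule divide_right_mono)
  also have "\<dots> = rc_connection_prob F B \<Lambda> \<sigma> nu \<Lambda>0 (hboundary B \<Lambda>1)"
    by (simp add: rc_connection_prob_def rc_prob_eq_sum[OF fin] sum_divide_distrib)
  finally show ?thesis unfolding d_def[symmetric] eq using Z0 by simp
qed

lemma sum_overlap_pairs:
  "(\<Sum>(\<omega>1, \<omega>2)\<in>overlap_pairs F \<Lambda> \<sigma>. f \<omega>1 \<omega>2)
    = (\<Sum>\<omega>\<in>compatible_configs F \<sigma> \<Lambda>. f \<omega> (compl_config \<Lambda> \<sigma> \<omega>))"
proof (rule sum.reindex_bij_witness[of _ "\<lambda>\<omega>. (\<omega>, compl_config \<Lambda> \<sigma> \<omega>)" fst])
  fix p assume "p \<in> overlap_pairs F \<Lambda> \<sigma>"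
  then obtain \<omega>1 \<omega>2 where p: "p = (\<omega>1, \<omega>2)" "\<omega>1 \<in> \<Lambda> \<rightarrow>\<^sub>E F" "\<omega>2 \<in> \<Lambda> \<rightarrow>\<^sub>E F"
    and s: "\<And>i. i \<in> \<Lambda> \<Longrightarrow> \<sigma> i = \<omega>1 i + \<omega>2 i"
    by (auto simp: overlap_pairs_def)
  have \<omega>2: "compl_config \<Lambda> \<sigma> \<omega>1 = \<omega>2"
    using p(3) s by (auto simp: compl_config_def PiE_iff extensional_def fun_eq_iff)
  then show "(fst p, compl_config \<Lambda> \<sigma> (fst p)) = p" by (simp add: p)
  show "fst p \<in> compatible_configs F \<sigma> \<Lambda>"
    using p s by (auto simp: compatible_configs_def compatible_spins_def PiE_iff)
  show "f (fst p) (compl_config \<Lambda> \<sigma> (fst p)) = (case p of (\<omega>1, \<omega>2) \<Rightarrow> f \<omega>1 \<omega>2)"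
    using \<omega>2 by (simp add: p)
next
  fix \<omega> assume \<omega>: "\<omega> \<in> compatible_configs F \<sigma> \<Lambda>"
  have "\<sigma> i - \<omega> i \<in> F" if "i \<in> \<Lambda>" for i
  proof -
    have "\<omega> i \<in> compatible_spins F (\<sigma> i)"
      using \<omega> that by (auto simp: compatible_configs_def)
    from compatible_spins_compl[OF this] show ?thesis by (simp add: compatible_spins_def)
  qed
  then show "(\<omega>, compl_config \<Lambda> \<sigma> \<omega>) \<in> overlap_pairs F \<Lambda> \<sigma>"
    using \<omega> by (auto simp: overlap_pairs_def compatible_configs_def compatible_spins_def compl_config_def PiE_iff)
qed simp

lemma finite_overlap_configs:
  assumes "finite F" "finite \<Lambda>"
  shows "finite (overlap_configs F \<Lambda>)"
proof -
  have "overlap_alphabet F = (\<lambda>(a, b). a + b) ` (F \<times> F)" by (auto simp: overlap_alphabet_def)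
  then show ?thesis using assms by (intro finite_PiE) auto
qed

lemma sum_over_overlaps:
  assumes "finite F" "finite \<Lambda>"
  shows "(\<Sum>\<sigma>\<in>overlap_configs F \<Lambda>. \<Sum>(\<omega>1, \<omega>2)\<in>overlap_pairs F \<Lambda> \<sigma>. f \<omega>1 \<omega>2)
    = (\<Sum>\<omega>1\<in>\<Lambda> \<rightarrow>\<^sub>E F. \<Sum>\<omega>2\<in>\<Lambda> \<rightarrow>\<^sub>E F. f \<omega>1 \<omega>2)"
proof -
  let ?P = "(\<Lambda> \<rightarrow>\<^sub>E F) \<times> (\<Lambda> \<rightarrow>\<^sub>E F)"
  let ?s = "\<lambda>(\<omega>1, \<omega>2). (\<lambda>i\<in>\<Lambda>. \<omega>1 i + \<omega>2 i) :: 'a config"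
  have "finite (overlap_configs F \<Lambda>)" by (rule finite_overlap_configs[OF assms])
  moreover have "finite ?P" using assms by (intro finite_cartesian_product finite_PiE) auto
  moreover have "?s ` ?P \<subseteq> overlap_configs F \<Lambda>"
    by (fastforce simp: overlap_alphabet_def PiE_iff)
  ultimately have "(\<Sum>\<sigma>\<in>overlap_configs F \<Lambda>. \<Sum>p\<in>{p \<in> ?P. ?s p = \<sigma>}. case p of (\<omega>1, \<omega>2) \<Rightarrow> f \<omega>1 \<omega>2)
      = (\<Sum>p\<in>?P. case p of (\<omega>1, \<omega>2) \<Rightarrow> f \<omega>1 \<omega>2)"
    by (intro sum.group)
  moreover have "{p \<in> ?P. ?s p = \<sigma>} = overlap_pairs F \<Lambda> \<sigma>" if "\<sigma> \<in> overlap_configs F \<Lambda>" for \<sigma>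
  proof -
    have "(\<lambda>i\<in>\<Lambda>. \<omega>1 i + \<omega>2 i) = \<sigma> \<longleftrightarrow> (\<forall>i\<in>\<Lambda>. \<omega>1 i + \<omega>2 i = \<sigma> i)" for \<omega>1 \<omega>2 :: "'a config"
    proof
      assume "\<forall>i\<in>\<Lambda>. \<omega>1 i + \<omega>2 i = \<sigma> i"
      then show "(\<lambda>i\<in>\<Lambda>. \<omega>1 i + \<omega>2 i) = \<sigma>"
        using that by (intro extensionalityI[of _ \<Lambda>]) (auto simp: PiE_iff)
    qed auto
    then show ?thesis by (auto simp: overlap_pairs_def)
  qed
  ultimately show ?thesis by (simp add: sum.cartesian_product)
qed

lemma integrated_connection_prob_eq:
  assumes "finite F" "locally_finite_hyperbonds B" "finite \<Lambda>"
  shows "integrated_connection_prob F B \<Lambda> m nu M1 M2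
    = (\<Sum>\<sigma>\<in>overlap_configs F \<Lambda>. overlap_dist F \<Lambda> m \<sigma> * rc_connection_prob F B \<Lambda> \<sigma> (nu \<sigma>) M1 M2)"
proof -
  let ?A = "{\<alpha> \<in> Pow (touching B \<Lambda>). connected_by \<alpha> M1 M2}"
  have "rc_connection_prob F B \<Lambda> \<sigma> (nu \<sigma>) M1 M2 = (\<Sum>\<alpha>\<in>?A. active_dist F B \<Lambda> \<sigma> (nu \<sigma>) \<alpha>)" for \<sigma>
    unfolding rc_connection_prob_def active_dist_def
    by (rule sum_rc_configs_by_active_set[OF assms])
  then show ?thesis
    unfolding integrated_connection_prob_def integrated_active_dist_def
    by (simp only: sum_distrib_left) (rule sum.swap)
qed

text \<open>Decomposing two independent copies according to their sum \<open>\<sigma>\<close>, the covariance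
  is \<open>\<Sum>\<sigma>. d \<sigma>\<close>, where \<open>d \<sigma>\<close> compares \<open>P \<omega>1
  \<and> Q \<omega>1\<close> with \<open>P \<omega>2 \<and> Q \<omega>1\<close>. Each term is at most
  \<open>\<rho> \<sigma>\<close> times the connection probability, and in any case at most \<open>\<rho>
  \<sigma>\<close>; the second bound takes care of the exceptional \<open>\<sigma>\<close> in the alternative
  hypothesis, which accounts for the factor 2.\<close>

lemma finite_volume_correlation_bound:
  assumes fin: "finite F" "locally_finite_hyperbonds B" "finite \<Lambda>"
    and m0: "\<And>\<omega>. \<omega> \<in> \<Lambda> \<rightarrow>\<^sub>E F \<Longrightarrow> m \<omega> \<ge> 0" and m1: "(\<Sum>\<omega>\<in>\<Lambda> \<rightarrow>\<^sub>E F. m \<omega>) = 1"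
    and rcr: "\<And>\<sigma>. \<sigma> \<in> overlap_configs F \<Lambda> \<Longrightarrow> overlap_dist F \<Lambda> m \<sigma> > 0 \<Longrightarrow>
        bernoulli_RCR F B \<Lambda> m \<sigma> (nu \<sigma>) \<and> exchange_symmetric F B \<Lambda> \<sigma> (nu \<sigma>)"
    and sub: "\<Lambda>0 \<subseteq> \<Lambda>1" "\<Lambda>0 \<subseteq> \<Lambda>" "C \<inter> \<Lambda>1 = {}" "C \<subseteq> \<Lambda>"
    and loc: "local_event \<Lambda>0 P" "local_event C Q"
    and conn: "integrated_connection_prob F B \<Lambda> m nu \<Lambda>0 (hboundary B \<Lambda>1) \<le> \<epsilon>
      \<or> (\<Sum>\<sigma>\<in>{\<sigma> \<in> overlap_configs F \<Lambda>. rc_connection_prob F B \<Lambda> \<sigma> (nu \<sigma>) \<Lambda>0 (hboundary B \<Lambda>1) \<le> \<epsilon>}.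
           overlap_dist F \<Lambda> m \<sigma>) \<ge> 1 - \<epsilon>"
    and \<epsilon>: "\<epsilon> > 0"
  shows "\<bar>(\<Sum>\<omega>\<in>{\<omega> \<in> \<Lambda> \<rightarrow>\<^sub>E F. P \<omega> \<and> Q \<omega>}. m \<omega>)
    - (\<Sum>\<omega>\<in>{\<omega> \<in> \<Lambda> \<rightarrow>\<^sub>E F. P \<omega>}. m \<omega>) * (\<Sum>\<omega>\<in>{\<omega> \<in> \<Lambda> \<rightarrow>\<^sub>E F. Q \<omega>}. m \<omega>)\<bar> \<le> 2 * \<epsilon>"
proof -
  let ?\<Sigma> = "overlap_configs F \<Lambda>" and ?\<Omega> = "\<Lambda> \<rightarrow>\<^sub>E F"
  let ?c = "compl_config \<Lambda>" and ?\<rho> = "overlap_dist F \<Lambda> m"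
  let ?K = "\<lambda>\<sigma>. rc_connection_prob F B \<Lambda> \<sigma> (nu \<sigma>) \<Lambda>0 (hboundary B \<Lambda>1)"
  define D where "D \<omega>1 \<omega>2 = (of_bool (P \<omega>1 \<and> Q \<omega>1) - of_bool (P \<omega>2 \<and> Q \<omega>1) :: real)" for \<omega>1 \<omega>2
  define d where "d \<sigma> = (\<Sum>(\<omega>1, \<omega>2)\<in>overlap_pairs F \<Lambda> \<sigma>. m \<omega>1 * m \<omega>2 * D \<omega>1 \<omega>2)" for \<sigma>
  have fin\<Omega>: "finite ?\<Omega>" using fin by (intro finite_PiE) auto
  have fin\<Sigma>: "finite ?\<Sigma>" by (rule finite_overlap_configs[OF fin(1,3)])
  have D1: "\<bar>D \<omega>1 \<omega>2\<bar> \<le> 1" for \<omega>1 \<omega>2 by (simp add: D_def)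
  have mm: "m \<omega>1 * m \<omega>2 \<ge> 0" if "(\<omega>1, \<omega>2) \<in> overlap_pairs F \<Lambda> \<sigma>" for \<omega>1 \<omega>2 \<sigma>
    using that m0 by (auto simp: overlap_pairs_def)
  have \<rho>0: "?\<rho> \<sigma> \<ge> 0" for \<sigma>
    unfolding overlap_dist_def using mm by (intro sum_nonneg) auto
  have \<rho>1: "(\<Sum>\<sigma>\<in>?\<Sigma>. ?\<rho> \<sigma>) = 1"
    unfolding overlap_dist_def sum_over_overlaps[OF fin(1,3)]
    by (simp add: m1 flip: sum_distrib_left)
  have d\<rho>: "\<bar>d \<sigma>\<bar> \<le> ?\<rho> \<sigma>" for \<sigma>
  proof -
    have "\<bar>d \<sigma>\<bar> \<le> (\<Sum>p\<in>overlap_pairs F \<Lambda> \<sigma>. \<bar>case p of (\<omega>1, \<omega>2) \<Rightarrow> m \<omega>1 * m \<omega>2 * D \<omega>1 \<omega>2\<bar>)"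
      unfolding d_def by (rule sum_abs)
    also have "\<dots> \<le> ?\<rho> \<sigma>"
      unfolding overlap_dist_def
    proof (rule sum_mono)
      fix p assume p: "p \<in> overlap_pairs F \<Lambda> \<sigma>"
      obtain \<omega>1 \<omega>2 where [simp]: "p = (\<omega>1, \<omega>2)" by fastforce
      have "\<bar>m \<omega>1 * m \<omega>2\<bar> = m \<omega>1 * m \<omega>2" using mm p by simp
      then show "\<bar>case p of (\<omega>1, \<omega>2) \<Rightarrow> m \<omega>1 * m \<omega>2 * D \<omega>1 \<omega>2\<bar> \<le> (case p of (\<omega>1, \<omega>2) \<Rightarrow> m \<omega>1 * m \<omega>2)"
        using mult_left_le[OF D1, of "m \<omega>1 * m \<omega>2" \<omega>1 \<omega>2] mm p
        by (simp add: abs_mult[of "m \<omega>1 * m \<omega>2"])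
    qed
    finally show ?thesis .
  qed
  \<comment> \<open>a random cluster representation is given only where the overlap has positive mass\<close>
  have dK: "\<bar>d \<sigma>\<bar> \<le> ?\<rho> \<sigma> * ?K \<sigma>" if \<sigma>: "\<sigma> \<in> ?\<Sigma>" for \<sigma>
  proof (cases "?\<rho> \<sigma> = 0")
    case True
    then show ?thesis using d\<rho>[of \<sigma>] by simp
  next
    case False
    then have pos: "?\<rho> \<sigma> > 0" using \<rho>0[of \<sigma>] by simp
    have "d \<sigma> = (\<Sum>\<omega>\<in>compatible_configs F \<sigma> \<Lambda>. m \<omega> * m (?c \<sigma> \<omega>) * D \<omega> (?c \<sigma> \<omega>))"
      unfolding d_def by (rule sum_overlap_pairs)
    also have "\<dots> = ?\<rho> \<sigma> * (\<Sum>\<omega>\<in>compatible_configs F \<sigma> \<Lambda>. nonoverlap_dist F \<Lambda> m \<sigma> \<omega> * D \<omega> (?c \<sigma> \<omega>))"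
      using pos by (simp add: nonoverlap_dist_def sum_distrib_left)
    finally have "\<bar>d \<sigma>\<bar> = ?\<rho> \<sigma> * \<bar>\<Sum>\<omega>\<in>compatible_configs F \<sigma> \<Lambda>. nonoverlap_dist F \<Lambda> m \<sigma> \<omega> * D \<omega> (?c \<sigma> \<omega>)\<bar>"
      using pos by (simp add: abs_mult)
    also have "\<dots> \<le> ?\<rho> \<sigma> * ?K \<sigma>"
      unfolding D_def using rcr[OF \<sigma> pos] pos
      by (intro mult_left_mono nonoverlap_exchange_bound[OF fin _ _ sub loc]) auto
    finally show ?thesis .
  qed
  have "(\<Sum>\<sigma>\<in>?\<Sigma>. d \<sigma>) = (\<Sum>\<omega>1\<in>?\<Omega>. \<Sum>\<omega>2\<in>?\<Omega>. m \<omega>1 * m \<omega>2 * D \<omega>1 \<omega>2)"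
    unfolding d_def by (rule sum_over_overlaps[OF fin(1,3)])
  also have "\<dots> = (\<Sum>\<omega>1\<in>?\<Omega>. m \<omega>1 * of_bool (P \<omega>1 \<and> Q \<omega>1)) * (\<Sum>\<omega>2\<in>?\<Omega>. m \<omega>2)
      - (\<Sum>\<omega>1\<in>?\<Omega>. m \<omega>1 * of_bool (Q \<omega>1)) * (\<Sum>\<omega>2\<in>?\<Omega>. m \<omega>2 * of_bool (P \<omega>2))"
    unfolding sum_product sum_subtractf[symmetric]
    by (intro sum.cong refl) (auto simp: D_def algebra_simps)
  also have "\<dots> = (\<Sum>\<omega>\<in>{\<omega> \<in> ?\<Omega>. P \<omega> \<and> Q \<omega>}. m \<omega>)
      - (\<Sum>\<omega>\<in>{\<omega> \<in> ?\<Omega>. P \<omega>}. m \<omega>) * (\<Sum>\<omega>\<in>{\<omega> \<in> ?\<Omega>. Q \<omega>}. m \<omega>)"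
  proof -
    have "(\<Sum>\<omega>\<in>{\<omega> \<in> ?\<Omega>. R \<omega>}. m \<omega>) = (\<Sum>\<omega>\<in>?\<Omega>. m \<omega> * of_bool (R \<omega>))" for R
      by (subst sum.inter_filter[OF fin\<Omega>]) (auto intro!: sum.cong)
    then show ?thesis by (simp add: m1)
  qed
  finally have cov: "(\<Sum>\<omega>\<in>{\<omega> \<in> ?\<Omega>. P \<omega> \<and> Q \<omega>}. m \<omega>)
      - (\<Sum>\<omega>\<in>{\<omega> \<in> ?\<Omega>. P \<omega>}. m \<omega>) * (\<Sum>\<omega>\<in>{\<omega> \<in> ?\<Omega>. Q \<omega>}. m \<omega>) = (\<Sum>\<sigma>\<in>?\<Sigma>. d \<sigma>)" ..
  have "\<bar>\<Sum>\<sigma>\<in>?\<Sigma>. d \<sigma>\<bar> \<le> (\<Sum>\<sigma>\<in>?\<Sigma>. \<bar>d \<sigma>\<bar>)" by (rule sum_abs)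
  also have "\<dots> \<le> 2 * \<epsilon>"
    using conn
  proof
    assume "integrated_connection_prob F B \<Lambda> m nu \<Lambda>0 (hboundary B \<Lambda>1) \<le> \<epsilon>"
    then have "(\<Sum>\<sigma>\<in>?\<Sigma>. ?\<rho> \<sigma> * ?K \<sigma>) \<le> \<epsilon>" by (simp add: integrated_connection_prob_eq[OF fin])
    moreover have "(\<Sum>\<sigma>\<in>?\<Sigma>. \<bar>d \<sigma>\<bar>) \<le> (\<Sum>\<sigma>\<in>?\<Sigma>. ?\<rho> \<sigma> * ?K \<sigma>)" by (intro sum_mono dK)
    ultimately show ?thesis using \<epsilon> by simp
  next
    let ?G = "{\<sigma> \<in> ?\<Sigma>. ?K \<sigma> \<le> \<epsilon>}"
    assume good: "(\<Sum>\<sigma>\<in>?G. ?\<rho> \<sigma>) \<ge> 1 - \<epsilon>"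
    have sub: "?G \<subseteq> ?\<Sigma>" by auto
    have split: "(\<Sum>\<sigma>\<in>?\<Sigma>. h \<sigma>) = (\<Sum>\<sigma>\<in>?\<Sigma> - ?G. h \<sigma>) + (\<Sum>\<sigma>\<in>?G. h \<sigma>)" for h :: "'a config \<Rightarrow> real"
      by (rule sum.subset_diff[OF sub fin\<Sigma>])
    have "(\<Sum>\<sigma>\<in>?G. \<bar>d \<sigma>\<bar>) \<le> (\<Sum>\<sigma>\<in>?G. ?\<rho> \<sigma> * \<epsilon>)"
      using \<rho>0 by (intro sum_mono order_trans[OF dK] mult_left_mono) auto
    also have "\<dots> \<le> (\<Sum>\<sigma>\<in>?\<Sigma>. ?\<rho> \<sigma> * \<epsilon>)"
      using \<rho>0 \<epsilon> fin\<Sigma> by (intro sum_mono2) auto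
    also have "\<dots> = \<epsilon>" by (simp add: \<rho>1 flip: sum_distrib_right)
    finally have "(\<Sum>\<sigma>\<in>?G. \<bar>d \<sigma>\<bar>) \<le> \<epsilon>" .
    moreover have "(\<Sum>\<sigma>\<in>?\<Sigma> - ?G. \<bar>d \<sigma>\<bar>) \<le> (\<Sum>\<sigma>\<in>?\<Sigma> - ?G. ?\<rho> \<sigma>)" by (intro sum_mono d\<rho>)
    moreover have "(\<Sum>\<sigma>\<in>?\<Sigma> - ?G. ?\<rho> \<sigma>) \<le> \<epsilon>" using split[of ?\<rho>] good \<rho>1 by simp
    ultimately show ?thesis using split[of "\<lambda>\<sigma>. \<bar>d \<sigma>\<bar>"] by simp
  qed
  finally show ?thesis unfolding cov .
qed

section \<open>Extremality\<close>

lemma prob_local_sum: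
  assumes "config_measure F M" "finite F" "finite C" "finite D" "local_event D R" "S \<subseteq> C \<rightarrow>\<^sub>E F"
  shows "\<P>(x in M. R x \<and> restrict x C \<in> S) = (\<Sum>y\<in>S. \<P>(x in M. R x \<and> restrict x C = y))"
proof -
  have "\<P>(x in M. R x \<and> restrict x C \<in> S)
      = (\<Sum>y\<in>C \<rightarrow>\<^sub>E F. \<P>(x in M. (R x \<and> restrict x C \<in> S) \<and> restrict x C = y))"
    using assms
    by (intro prob_split_local[of F M C "D \<union> C"] local_event_conj local_event_restrict) auto
  also have "\<dots> = (\<Sum>y\<in>S. \<P>(x in M. (R x \<and> restrict x C \<in> S) \<and> restrict x C = y))"
  proof (rule sum.mono_neutral_right[OF _ assms(6)])
    show "finite (C \<rightarrow>\<^sub>E F)" using assms by (intro finite_PiE) auto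
    show "\<forall>y\<in>(C \<rightarrow>\<^sub>E F) - S. \<P>(x in M. (R x \<and> restrict x C \<in> S) \<and> restrict x C = y) = 0"
    proof
      fix y assume "y \<in> (C \<rightarrow>\<^sub>E F) - S"
      then have "{x \<in> space M. (R x \<and> restrict x C \<in> S) \<and> restrict x C = y} = {}" by auto
      then show "\<P>(x in M. (R x \<and> restrict x C \<in> S) \<and> restrict x C = y) = 0"
        by (metis measure_empty)
    qed
  qed
  also have "\<dots> = (\<Sum>y\<in>S. \<P>(x in M. R x \<and> restrict x C = y))"
    by (intro sum.cong refl arg_cong[of _ _ "measure M"]) auto
  finally show ?thesis .
qed

lemma gibbs_state_prob_given_boundary:
  assumes M: "M \<in> gibbs_states F B \<phi>" and F: "finite F" and B: "locally_finite_hyperbonds B"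
    and \<Delta>: "finite \<Delta>" and P: "local_event \<Delta> P"
  shows "\<P>(x in M. P x \<and> restrict x (outer_nbhd B \<Delta>) = y)
    = (\<Sum>\<xi>\<in>{\<xi> \<in> \<Delta> \<rightarrow>\<^sub>E F. P \<xi>}. gibbs F B \<phi> \<Delta> y \<xi>) * \<P>(x in M. restrict x (outer_nbhd B \<Delta>) = y)"
proof -
  let ?C = "outer_nbhd B \<Delta>"
  have C: "finite ?C" "?C \<inter> \<Delta> = {}"
    using finite_outer_nbhd[OF B \<Delta>] by (auto simp: outer_nbhd_def)
  have cm: "config_measure F M" and dlr: "local_DLR F B \<phi> M \<Delta>"
    using M \<Delta> by (auto simp: gibbs_states_iff_local_DLR[OF F B])
  have "\<P>(x in M. P x \<and> restrict x ?C = y)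
      = measure M {x \<in> space M. restrict x ?C = y \<and> restrict x \<Delta> \<in> {\<xi> \<in> \<Delta> \<rightarrow>\<^sub>E F. P \<xi>}}"
    using space_config_measure[OF cm] local_event_restrict_iff[OF P]
    by (intro arg_cong[of _ _ "measure M"]) (auto simp: PiE_iff)
  also have "\<dots> = (\<Sum>\<xi>\<in>{\<xi> \<in> \<Delta> \<rightarrow>\<^sub>E F. P \<xi>}. \<P>(x in M. restrict x ?C = y \<and> restrict x \<Delta> = \<xi>))"
    by (rule prob_local_sum[OF cm F \<Delta> C(1) local_event_eq]) auto
  also have "\<dots> = (\<Sum>\<xi>\<in>{\<xi> \<in> \<Delta> \<rightarrow>\<^sub>E F. P \<xi>}. gibbs F B \<phi> \<Delta> y \<xi> * \<P>(x in M. restrict x ?C = y))"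
    using dlr C by (intro sum.cong refl) (auto simp: local_DLR_def conj_commute)
  finally show ?thesis by (simp add: sum_distrib_right)
qed

text \<open>With \<open>\<gamma> y\<close> the common conditional probability of \<open>P\<close> given the
  boundary value \<open>y\<close> and \<open>p = M(P)\<close>, both \<open>N(P) - p\<close> and the
  covariances under \<open>M\<close> are sums of \<open>\<gamma> y - p\<close> over boundary values, weighted
  by their probabilities under \<open>N\<close> and \<open>M\<close>. Splitting by the sign of \<open>\<gamma>
  y - p\<close> bounds its \<open>L1(M)\<close> norm by two covariances.\<close>

lemma dominated_gibbs_state_close:
  assumes M: "M \<in> gibbs_states F B \<phi>" and N: "N \<in> gibbs_states F B \<phi>"
    and F: "finite F" and B: "locally_finite_hyperbonds B"
    and t: "t > 0" and dom: "\<And>A. A \<in> sets M \<Longrightarrow> t * measure N A \<le> measure M A"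
    and \<Delta>: "finite \<Delta>" and P: "local_event \<Delta> P"
    and cor: "\<And>Q. local_event (outer_nbhd B \<Delta>) Q \<Longrightarrow>
      \<bar>\<P>(x in M. P x \<and> Q x) - \<P>(x in M. P x) * \<P>(x in M. Q x)\<bar> \<le> \<delta>"
  shows "\<bar>\<P>(x in N. P x) - \<P>(x in M. P x)\<bar> \<le> 2 * \<delta> / t"
proof -
  let ?C = "outer_nbhd B \<Delta>"
  have C: "finite ?C" using finite_outer_nbhd[OF B \<Delta>] .
  have cm: "config_measure F M" and cn: "config_measure F N"
    using M N by (auto simp: gibbs_states_def)
  interpret N: prob_space N by (rule prob_space_config_measure[OF cn])
  define p where "p = \<P>(x in M. P x)"
  define \<gamma> where "\<gamma> y = (\<Sum>\<xi>\<in>{\<xi> \<in> \<Delta> \<rightarrow>\<^sub>E F. P \<xi>}. gibbs F B \<phi> \<Delta> y \<xi>)" for y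
  define E where "E G y = \<P>(x in G. restrict x ?C = y)" for G :: "'a config measure" and y
  let ?Y = "?C \<rightarrow>\<^sub>E F"
  have finY: "finite ?Y" using C F by (intro finite_PiE) auto
  have "\<P>(x in N. P x) = (\<Sum>y\<in>?Y. \<P>(x in N. P x \<and> restrict x ?C = y))"
    by (rule prob_split_local[OF cn F C \<Delta> P])
  also have "\<dots> = (\<Sum>y\<in>?Y. \<gamma> y * E N y)"
    unfolding \<gamma>_def E_def by (intro sum.cong refl gibbs_state_prob_given_boundary[OF N F B \<Delta> P])
  finally have NP: "\<P>(x in N. P x) = (\<Sum>y\<in>?Y. \<gamma> y * E N y)" .
  have "\<P>(x in N. True) = (\<Sum>y\<in>?Y. \<P>(x in N. True \<and> restrict x ?C = y))"
    by (rule prob_split_local[OF cn F C C]) (simp add: local_event_def)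
  then have N1: "(\<Sum>y\<in>?Y. E N y) = 1" by (simp add: E_def N.prob_space)
  have "\<P>(x in N. P x) - p = (\<Sum>y\<in>?Y. (\<gamma> y - p) * E N y)"
    using NP N1 by (simp add: left_diff_distrib sum_subtractf flip: sum_distrib_left)
  then have "\<bar>\<P>(x in N. P x) - p\<bar> \<le> (\<Sum>y\<in>?Y. \<bar>(\<gamma> y - p) * E N y\<bar>)"
    using sum_abs by simp
  also have "\<dots> \<le> (\<Sum>y\<in>?Y. \<bar>\<gamma> y - p\<bar> * (E M y / t))"
  proof (intro sum_mono)
    fix y
    have "{x \<in> space M. restrict x ?C = y} \<in> sets M"
      by (rule local_event_sets[OF cm F C local_event_eq]) simp
    from dom[OF this] have "E N y \<le> E M y / t"
      using t space_config_measure[OF cm] space_config_measure[OF cn]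
      by (simp add: E_def pos_le_divide_eq mult.commute)
    then have "\<bar>\<gamma> y - p\<bar> * E N y \<le> \<bar>\<gamma> y - p\<bar> * (E M y / t)"
      by (rule mult_left_mono) simp
    moreover have "E N y \<ge> 0" by (simp add: E_def)
    ultimately show "\<bar>(\<gamma> y - p) * E N y\<bar> \<le> \<bar>\<gamma> y - p\<bar> * (E M y / t)"
      by (simp add: abs_mult)
  qed
  also have "\<dots> = (\<Sum>y\<in>?Y. \<bar>\<gamma> y - p\<bar> * E M y) / t"
    by (simp add: sum_divide_distrib)
  also have "(\<Sum>y\<in>?Y. \<bar>\<gamma> y - p\<bar> * E M y) \<le> 2 * \<delta>"
  proof -
    have part: "\<bar>\<Sum>y\<in>S. (\<gamma> y - p) * E M y\<bar> \<le> \<delta>" if S: "S \<subseteq> ?Y" for S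
    proof -
      have "\<P>(x in M. P x \<and> restrict x ?C \<in> S) = (\<Sum>y\<in>S. \<P>(x in M. P x \<and> restrict x ?C = y))"
        by (rule prob_local_sum[OF cm F C \<Delta> P S])
      also have "\<dots> = (\<Sum>y\<in>S. \<gamma> y * E M y)"
        unfolding \<gamma>_def E_def by (intro sum.cong refl gibbs_state_prob_given_boundary[OF M F B \<Delta> P])
      finally have 1: "\<P>(x in M. P x \<and> restrict x ?C \<in> S) = (\<Sum>y\<in>S. \<gamma> y * E M y)" .
      have "\<P>(x in M. True \<and> restrict x ?C \<in> S) = (\<Sum>y\<in>S. \<P>(x in M. True \<and> restrict x ?C = y))"
        by (rule prob_local_sum[OF cm F C C _ S]) (simp add: local_event_def)
      then have 2: "\<P>(x in M. restrict x ?C \<in> S) = (\<Sum>y\<in>S. E M y)" by (simp add: E_def)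
      have "(\<Sum>y\<in>S. (\<gamma> y - p) * E M y) = \<P>(x in M. P x \<and> restrict x ?C \<in> S) - p * \<P>(x in M. restrict x ?C \<in> S)"
        by (simp add: 1 2 left_diff_distrib sum_subtractf flip: sum_distrib_left)
      then show ?thesis using cor[OF local_event_restrict] by (simp add: p_def)
    qed
    \<comment> \<open>on each of the two sign classes the sum of absolute values is a single covariance up to sign\<close>
    let ?S = "{y \<in> ?Y. \<gamma> y \<ge> p}"
    have "(\<Sum>y\<in>?Y. \<bar>\<gamma> y - p\<bar> * E M y)
        = (\<Sum>y\<in>?Y - ?S. \<bar>\<gamma> y - p\<bar> * E M y) + (\<Sum>y\<in>?S. \<bar>\<gamma> y - p\<bar> * E M y)"
      by (rule sum.subset_diff[OF _ finY]) auto
    also have "(\<Sum>y\<in>?Y - ?S. \<bar>\<gamma> y - p\<bar> * E M y) = - (\<Sum>y\<in>?Y - ?S. (\<gamma> y - p) * E M y)"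
      unfolding sum_negf[symmetric] by (intro sum.cong refl) (auto simp: left_diff_distrib)
    also have "(\<Sum>y\<in>?S. \<bar>\<gamma> y - p\<bar> * E M y) = (\<Sum>y\<in>?S. (\<gamma> y - p) * E M y)"
      by (intro sum.cong refl) auto
    finally show ?thesis using part[of ?S] part[of "?Y - ?S"] by auto
  qed
  finally show ?thesis using t by (simp add: p_def divide_right_mono)
qed

text \<open>It suffices to control events \<open>Q\<close> on the outer neighbourhood of
  \<open>\<Delta>\<close>, because the conditional law in \<open>\<Delta>\<close> depends on nothing
  else.\<close>

lemma extremal_if_short_range_correlations:
  assumes M: "M \<in> gibbs_states F B \<phi>" and F: "finite F" and B: "locally_finite_hyperbonds B"
    and cor: "\<And>\<Lambda>0 P \<delta>. finite \<Lambda>0 \<Longrightarrow> local_event \<Lambda>0 P \<Longrightarrow> \<delta> > 0 \<Longrightarrow>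
      \<exists>\<Delta>. finite \<Delta> \<and> \<Lambda>0 \<subseteq> \<Delta> \<and> (\<forall>Q. local_event (outer_nbhd B \<Delta>) Q \<longrightarrow>
        \<bar>\<P>(x in M. P x \<and> Q x) - \<P>(x in M. P x) * \<P>(x in M. Q x)\<bar> \<le> \<delta>)"
  shows "extremal_in M (gibbs_states F B \<phi>)"
proof -
  have component: "N = M"
    if N: "N \<in> gibbs_states F B \<phi>" and t: "t > 0"
      and dom: "\<And>A. A \<in> sets M \<Longrightarrow> t * measure N A \<le> measure M A" for N and t :: real
  proof (rule config_measure_eqI[OF _ _ F])
    show "config_measure F N" "config_measure F M" using M N by (auto simp: gibbs_states_def)
    fix C :: "'a set" and P assume C: "finite C" "local_event C P"
    have "\<bar>\<P>(x in N. P x) - \<P>(x in M. P x)\<bar> \<le> 0 + e" if e: "e > 0" for e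
    proof -
      \<comment> \<open>e * t / 2 compensates the factor 2 / t lost in passing from M to N\<close>
      obtain \<Delta> where \<Delta>: "finite \<Delta>" "C \<subseteq> \<Delta>" and
        Q: "\<And>Q. local_event (outer_nbhd B \<Delta>) Q \<Longrightarrow>
          \<bar>\<P>(x in M. P x \<and> Q x) - \<P>(x in M. P x) * \<P>(x in M. Q x)\<bar> \<le> e * t / 2"
        using cor[OF C, of "e * t / 2"] e t by auto
      have "\<bar>\<P>(x in N. P x) - \<P>(x in M. P x)\<bar> \<le> 2 * (e * t / 2) / t"
        by (rule dominated_gibbs_state_close[OF M N F B t dom \<Delta>(1) local_event_mono[OF \<Delta>(2) C(2)] Q])
      then show ?thesis using t by simp
    qed
    then have "\<bar>\<P>(x in N. P x) - \<P>(x in M. P x)\<bar> \<le> 0" by (rule field_le_epsilon)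
    then show "\<P>(x in N. P x) = \<P>(x in M. P x)" by simp
  qed
  show ?thesis
    unfolding extremal_in_def
  proof (intro conjI M ballI allI impI)
    fix M1 M2 and t :: real
    assume M12: "M1 \<in> gibbs_states F B \<phi>" "M2 \<in> gibbs_states F B \<phi>" and t: "0 < t" "t < 1"
      and mix: "\<forall>A\<in>sets M. measure M A = t * measure M1 A + (1 - t) * measure M2 A"
    show "M1 = M" by (rule component[OF M12(1) t(1)]) (use mix t in auto)
    show "M2 = M" by (rule component[OF M12(2), of "1 - t"]) (use mix t in auto)
  qed
qed

theorem corollary3p3:
  fixes F :: "real set"
    and B :: "'v set set"
    and \<phi> :: "'v set \<Rightarrow> ('v \<Rightarrow> real) \<Rightarrow> ereal"
    and \<Lambda> :: "nat \<Rightarrow> 'v set"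
    and \<tau> :: "'v set \<Rightarrow> 'v \<Rightarrow> real"
    and nu :: "'v set \<Rightarrow> ('v \<Rightarrow> real) \<Rightarrow> 'v set \<Rightarrow> ('v \<Rightarrow> real) set \<Rightarrow> real"
    and M :: "('v \<Rightarrow> real) measure"
  assumes "infinite (UNIV :: 'v set)"
    and "finite F"
    and "locally_finite_hyperbonds B"
    and "is_interaction F B \<phi>"
    and "\<And>n. finite (\<Lambda> n)"
    and "filterlim \<Lambda> (finite_subsets_at_top UNIV) sequentially"
    and "\<And>n. \<tau> (\<Lambda> n) \<in> - \<Lambda> n \<rightarrow>\<^sub>E F"
    and "\<And>n. partition_function F B \<phi> (\<Lambda> n) (\<tau> (\<Lambda> n)) > 0"
    and "config_measure F M"
    and "converges_weakly F \<Lambda> (\<lambda>n. gibbs F B \<phi> (\<Lambda> n) (\<tau> (\<Lambda> n))) M"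
    and "\<And>n \<sigma>. \<sigma> \<in> overlap_configs F (\<Lambda> n) \<Longrightarrow>
           overlap_dist F (\<Lambda> n) (gibbs F B \<phi> (\<Lambda> n) (\<tau> (\<Lambda> n))) \<sigma> > 0 \<Longrightarrow>
           bernoulli_RCR F B (\<Lambda> n) (gibbs F B \<phi> (\<Lambda> n) (\<tau> (\<Lambda> n))) \<sigma> (nu (\<Lambda> n) \<sigma>) \<and>
           exchange_symmetric F B (\<Lambda> n) \<sigma> (nu (\<Lambda> n) \<sigma>)"
    and "\<And>\<Lambda>0 \<epsilon>. finite \<Lambda>0 \<Longrightarrow> \<epsilon> > 0 \<Longrightarrow>
           \<exists>\<Lambda>1 \<Lambda>2. finite \<Lambda>1 \<and> finite \<Lambda>2 \<and> \<Lambda>0 \<subseteq> \<Lambda>1 \<and>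
             (\<forall>n. \<Lambda>2 \<subseteq> \<Lambda> n \<longrightarrow>
                integrated_connection_prob F B (\<Lambda> n) (gibbs F B \<phi> (\<Lambda> n) (\<tau> (\<Lambda> n))) (nu (\<Lambda> n))
                  \<Lambda>0 (hboundary B \<Lambda>1) \<le> \<epsilon>
                \<or> (\<Sum>\<sigma>\<in>{\<sigma> \<in> overlap_configs F (\<Lambda> n).
                       rc_connection_prob F B (\<Lambda> n) \<sigma> (nu (\<Lambda> n) \<sigma>) \<Lambda>0 (hboundary B \<Lambda>1) \<le> \<epsilon>}.
                     overlap_dist F (\<Lambda> n) (gibbs F B \<phi> (\<Lambda> n) (\<tau> (\<Lambda> n))) \<sigma>) \<ge> 1 - \<epsilon>)"
  shows "extremal_in M (gibbs_states F B \<phi>)"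
proof (rule extremal_if_short_range_correlations[OF _ assms(2,3)])
  note F = assms(2) and B = assms(3) and cm = assms(9) and conv = assms(10)
  have \<tau>: "\<tau> (\<Lambda> n) \<in> - \<Lambda> n \<rightarrow> F" for n using assms(7)[of n] by auto
  show "M \<in> gibbs_states F B \<phi>"
    using cm weak_limit_local_DLR[OF F B assms(4-6) \<tau> cm conv]
    by (simp add: gibbs_states_iff_local_DLR[OF F B])
  fix \<Lambda>0 :: "'v set" and P and \<delta> :: real assume \<Lambda>0: "finite \<Lambda>0" and P: "local_event \<Lambda>0 P" and \<delta>: "\<delta> > 0"
  \<comment> \<open>half of the tolerance, since the finite volume bound has a factor 2\<close>
  obtain \<Lambda>1 \<Lambda>2 where sub: "finite \<Lambda>1" "finite \<Lambda>2" "\<Lambda>0 \<subseteq> \<Lambda>1"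
    and conn: "\<And>n. \<Lambda>2 \<subseteq> \<Lambda> n \<Longrightarrow>
        integrated_connection_prob F B (\<Lambda> n) (gibbs F B \<phi> (\<Lambda> n) (\<tau> (\<Lambda> n))) (nu (\<Lambda> n))
          \<Lambda>0 (hboundary B \<Lambda>1) \<le> \<delta> / 2
        \<or> (\<Sum>\<sigma>\<in>{\<sigma> \<in> overlap_configs F (\<Lambda> n).
               rc_connection_prob F B (\<Lambda> n) \<sigma> (nu (\<Lambda> n) \<sigma>) \<Lambda>0 (hboundary B \<Lambda>1) \<le> \<delta> / 2}.
             overlap_dist F (\<Lambda> n) (gibbs F B \<phi> (\<Lambda> n) (\<tau> (\<Lambda> n))) \<sigma>) \<ge> 1 - \<delta> / 2"
    using assms(12)[OF \<Lambda>0, of "\<delta> / 2"] \<delta> by auto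
  let ?C = "outer_nbhd B \<Lambda>1"
  have C: "finite ?C" "?C \<inter> \<Lambda>1 = {}"
    using finite_outer_nbhd[OF B sub(1)] by (auto simp: outer_nbhd_def)
  \<comment> \<open>Q lives outside \<open>\<Lambda>1\<close>, so the finite volume bound applies along the sequence\<close>
  have "\<bar>\<P>(x in M. P x \<and> Q x) - \<P>(x in M. P x) * \<P>(x in M. Q x)\<bar> \<le> \<delta>"
    if Q: "local_event ?C Q" for Q
  proof -
    let ?S = "\<lambda>n R. \<Sum>\<omega>\<in>{\<omega> \<in> \<Lambda> n \<rightarrow>\<^sub>E F. R \<omega>}. gibbs F B \<phi> (\<Lambda> n) (\<tau> (\<Lambda> n)) \<omega>"
    have large: "eventually (\<lambda>n. \<Lambda>0 \<subseteq> \<Lambda> n \<and> ?C \<subseteq> \<Lambda> n \<and> \<Lambda>2 \<subseteq> \<Lambda> n) sequentially"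
      using eventually_subset_volumes[OF assms(6)] \<Lambda>0 C(1) sub(2) by (simp add: eventually_conj_iff)
    have lim: "(\<lambda>n. ?S n R) \<longlonglongrightarrow> \<P>(x in M. R x)"
      if "local_event (\<Lambda>0 \<union> ?C) R" for R
      using \<Lambda>0 C(1) large that
      by (intro converges_weakly_local_event[OF conv cm, of "\<Lambda>0 \<union> ?C"]) (auto elim: eventually_mono)
    have "(\<lambda>n. \<bar>?S n (\<lambda>\<omega>. P \<omega> \<and> Q \<omega>) - ?S n P * ?S n Q\<bar>)
        \<longlonglongrightarrow> \<bar>\<P>(x in M. P x \<and> Q x) - \<P>(x in M. P x) * \<P>(x in M. Q x)\<bar>"
      using P Q
      by (intro tendsto_rabs tendsto_diff tendsto_mult lim local_event_conj)
        (auto intro: local_event_mono[rotated])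
    moreover have "eventually (\<lambda>n. \<bar>?S n (\<lambda>\<omega>. P \<omega> \<and> Q \<omega>) - ?S n P * ?S n Q\<bar> \<le> \<delta>) sequentially"
      using large
    proof eventually_elim
      case (elim n)
      have "\<bar>?S n (\<lambda>\<omega>. P \<omega> \<and> Q \<omega>) - ?S n P * ?S n Q\<bar> \<le> 2 * (\<delta> / 2)"
        by (rule finite_volume_correlation_bound[OF F B assms(5) gibbs_nonneg sum_gibbs[OF assms(8)]
              assms(11) sub(3) _ C(2) _ P Q conn]) (use elim \<delta> in auto)
      then show ?case by simp
    qed
    ultimately show ?thesis by (intro tendsto_upperbound[where F = sequentially]) auto
  qed
  then show "\<exists>\<Delta>. finite \<Delta> \<and> \<Lambda>0 \<subseteq> \<Delta> \<and> (\<forall>Q. local_event (outer_nbhd B \<Delta>) Q \<longrightarrow>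
        \<bar>\<P>(x in M. P x \<and> Q x) - \<P>(x in M. P x) * \<P>(x in M. Q x)\<bar> \<le> \<delta>)"
    using sub by blast
qed

end
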